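(* Let $\Sigma$ be a sentence or a theory, either first-order or second-order, in the language of set theory, and suppose $V_\kappa\models\Sigma$ for some inaccessible cardinal $\kappa$. Then either $\Sigma$ is a categorical characterization over ${\rm ZFC}_2$ of this model, i.e. $\kappa$ is the only inaccessible cardinal with $V_\kappa\models\Sigma$, or else it is consistent with ${\rm ZFC}_2$ that $\Sigma$ is such a categorical characterization, in the sense that there are inaccessible cardinals $\kappa'<\lambda$ such that $\kappa'$ is the only inaccessible cardinal below $\lambda$ with $V_{\kappa'}\models\Sigma$, so that $\langle V_\lambda,\in\rangle\models{\rm ZFC}_2$ and inside $V_\lambda$ the theory ${\rm ZFC}_2+\Sigma$ categorically characterizes $V_{\kappa'}$.
   Context: ${\rm ZFC}_2$ is second-order ZFC; its models are, up to isomorphism, exactly the structures $\langle V_\kappa,\in\rangle$ with $\kappa$ inaccessible, where $V_\kappa$ is the rank-initial segment of the cumulative hierarchy and second-order quantifiers range over all subsets of $V_\kappa$. *)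

theory Defs
  imports Complex_Main "HOL-Library.Countable_Set" "HOL-Library.Equipollence"
begin

section \<open>The background universe of sets\<close>

text \<open>
  The elements of the type are the sets of the background universe V, and HOL predicates and
  functions on the type play the role of its classes. The axiom of choice is not listed: it follows
  from Hilbert choice in HOL together with replacement.
\<close>

class zfc_universe =
  fixes elts :: "'a \<Rightarrow> 'a set"
  assumes extensionality_ax: "elts x = elts y \<Longrightarrow> x = y"
    and foundation_ax: "elts x \<noteq> {} \<Longrightarrow> \<exists>y\<in>elts x. elts y \<inter> elts x = {}"
    and pairing_ax: "\<exists>z. elts z = {x, y}"
    and union_ax: "\<exists>u. elts u = (\<Union>y\<in>elts x. elts y)"
    and power_ax: "\<exists>p. elts p = {z. elts z \<subseteq> elts x}"
    and infinity_ax: "\<exists>w. (\<exists>e\<in>elts w. elts e = {}) \<and>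
                          (\<forall>y\<in>elts w. \<exists>z\<in>elts w. elts z = insert y (elts y))"
    and separation_ax: "\<exists>b. elts b = {x \<in> elts a. P x}"
    and replacement_ax: "\<exists>b. elts b = f ` elts a"

abbreviation mem :: "'v::zfc_universe \<Rightarrow> 'v \<Rightarrow> bool" where
  "mem x y \<equiv> x \<in> elts y"

definition transitive_set :: "'v::zfc_universe \<Rightarrow> bool" where
  "transitive_set x \<longleftrightarrow> (\<forall>y\<in>elts x. elts y \<subseteq> elts x)"

text \<open>Von Neumann ordinals; the order on ordinals is membership.\<close>

definition ordinal :: "'v::zfc_universe \<Rightarrow> bool" where
  "ordinal \<alpha> \<longleftrightarrow> transitive_set \<alpha> \<and> (\<forall>\<beta>\<in>elts \<alpha>. transitive_set \<beta>)"

definition cardinal :: "'v::zfc_universe \<Rightarrow> bool" where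
  "cardinal \<kappa> \<longleftrightarrow> ordinal \<kappa> \<and> (\<forall>\<alpha>\<in>elts \<kappa>. elts \<alpha> \<prec> elts \<kappa>)"

definition regular :: "'v::zfc_universe \<Rightarrow> bool" where
  "regular \<kappa> \<longleftrightarrow> cardinal \<kappa> \<and> infinite (elts \<kappa>) \<and>
     (\<forall>\<alpha>\<in>elts \<kappa>. \<forall>f. f ` elts \<alpha> \<subseteq> elts \<kappa> \<longrightarrow> (\<exists>\<beta>\<in>elts \<kappa>. f ` elts \<alpha> \<subseteq> elts \<beta>))"

definition strong_limit :: "'v::zfc_universe \<Rightarrow> bool" where
  "strong_limit \<kappa> \<longleftrightarrow> cardinal \<kappa> \<and> (\<forall>\<alpha>\<in>elts \<kappa>. Pow (elts \<alpha>) \<prec> elts \<kappa>)"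

definition inaccessible :: "'v::zfc_universe \<Rightarrow> bool" where
  "inaccessible \<kappa> \<longleftrightarrow> uncountable (elts \<kappa>) \<and> regular \<kappa> \<and> strong_limit \<kappa>"

text \<open>
  The cumulative hierarchy, by the single clause that the stage at \<open>\<alpha>\<close> is the union over
  \<open>\<beta> \<in> \<alpha>\<close> of the power set of the stage at \<open>\<beta>\<close> (see \<open>Vset_iff\<close>). Since membership is
  well-founded, the least solution is the only one.
\<close>

inductive in_Vset :: "'v::zfc_universe \<Rightarrow> 'v \<Rightarrow> bool" where
  "\<beta> \<in> elts \<alpha> \<Longrightarrow> (\<And>y. y \<in> elts x \<Longrightarrow> in_Vset \<beta> y) \<Longrightarrow> in_Vset \<alpha> x"

definition Vset :: "'v::zfc_universe \<Rightarrow> 'v set" where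
  "Vset \<alpha> = {x. in_Vset \<alpha> x}"

lemma Vset_iff: "x \<in> Vset \<alpha> \<longleftrightarrow> (\<exists>\<beta>\<in>elts \<alpha>. elts x \<subseteq> Vset \<beta>)"
  unfolding Vset_def by (subst mem_Collect_eq, subst in_Vset.simps) auto


section \<open>Second-order logic in the language of set theory\<close>

text \<open>
  Relation variables are pairs of an arity and an index; the atom \<open>Rel X xs\<close> applies the relation
  variable \<open>(length xs, X)\<close>. The formulas without \<open>Rel\<close> and \<open>Forall2\<close> are the first-order ones.
\<close>

datatype fm =
    Mem nat nat
  | Eq nat nat
  | Rel nat "nat list"
  | Neg fm
  | And fm fm
  | Forall nat fm
  | Forall2 nat nat fm

abbreviation Or :: "fm \<Rightarrow> fm \<Rightarrow> fm" where "Or \<phi> \<psi> \<equiv> Neg (And (Neg \<phi>) (Neg \<psi>))"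
abbreviation Imp :: "fm \<Rightarrow> fm \<Rightarrow> fm" where "Imp \<phi> \<psi> \<equiv> Neg (And \<phi> (Neg \<psi>))"
abbreviation Iff :: "fm \<Rightarrow> fm \<Rightarrow> fm" where "Iff \<phi> \<psi> \<equiv> And (Imp \<phi> \<psi>) (Imp \<psi> \<phi>)"
abbreviation Exists :: "nat \<Rightarrow> fm \<Rightarrow> fm" where "Exists x \<phi> \<equiv> Neg (Forall x (Neg \<phi>))"

primrec fv1 :: "fm \<Rightarrow> nat set" where
  "fv1 (Mem x y) = {x, y}"
| "fv1 (Eq x y) = {x, y}"
| "fv1 (Rel X xs) = set xs"
| "fv1 (Neg \<phi>) = fv1 \<phi>"
| "fv1 (And \<phi> \<psi>) = fv1 \<phi> \<union> fv1 \<psi>"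
| "fv1 (Forall x \<phi>) = fv1 \<phi> - {x}"
| "fv1 (Forall2 n X \<phi>) = fv1 \<phi>"

primrec fv2 :: "fm \<Rightarrow> (nat \<times> nat) set" where
  "fv2 (Mem x y) = {}"
| "fv2 (Eq x y) = {}"
| "fv2 (Rel X xs) = {(length xs, X)}"
| "fv2 (Neg \<phi>) = fv2 \<phi>"
| "fv2 (And \<phi> \<psi>) = fv2 \<phi> \<union> fv2 \<psi>"
| "fv2 (Forall x \<phi>) = fv2 \<phi>"
| "fv2 (Forall2 n X \<phi>) = fv2 \<phi> - {(n, X)}"

definition sentence :: "fm \<Rightarrow> bool" where
  "sentence \<phi> \<longleftrightarrow> fv1 \<phi> = {} \<and> fv2 \<phi> = {}"

definition relations :: "'m set \<Rightarrow> nat \<Rightarrow> 'm list set set" where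
  "relations M n = Pow {xs. length xs = n \<and> set xs \<subseteq> M}"

text \<open>Full semantics: relation variables range over all relations on the carrier \<open>M\<close>.\<close>

primrec sat :: "'m set \<Rightarrow> ('m \<Rightarrow> 'm \<Rightarrow> bool) \<Rightarrow> (nat \<Rightarrow> 'm) \<Rightarrow> (nat \<times> nat \<Rightarrow> 'm list set) \<Rightarrow> fm \<Rightarrow> bool"
where
  "sat M E s r (Mem x y) \<longleftrightarrow> E (s x) (s y)"
| "sat M E s r (Eq x y) \<longleftrightarrow> s x = s y"
| "sat M E s r (Rel X xs) \<longleftrightarrow> map s xs \<in> r (length xs, X)"
| "sat M E s r (Neg \<phi>) \<longleftrightarrow> \<not> sat M E s r \<phi>"
| "sat M E s r (And \<phi> \<psi>) \<longleftrightarrow> sat M E s r \<phi> \<and> sat M E s r \<psi>"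
| "sat M E s r (Forall x \<phi>) \<longleftrightarrow> (\<forall>a\<in>M. sat M E (s(x := a)) r \<phi>)"
| "sat M E s r (Forall2 n X \<phi>) \<longleftrightarrow> (\<forall>A\<in>relations M n. sat M E s (r((n, X) := A)) \<phi>)"

definition models :: "'m set \<Rightarrow> ('m \<Rightarrow> 'm \<Rightarrow> bool) \<Rightarrow> fm set \<Rightarrow> bool" where
  "models M E T \<longleftrightarrow> M \<noteq> {} \<and>
     (\<forall>\<phi>\<in>T. \<forall>s r. (\<forall>x. s x \<in> M) \<longrightarrow> (\<forall>n X. r (n, X) \<in> relations M n) \<longrightarrow> sat M E s r \<phi>)"

definition isomorphic ::
  "'m set \<Rightarrow> ('m \<Rightarrow> 'm \<Rightarrow> bool) \<Rightarrow> 'n set \<Rightarrow> ('n \<Rightarrow> 'n \<Rightarrow> bool) \<Rightarrow> bool" where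
  "isomorphic M E N F \<longleftrightarrow>
     (\<exists>f. bij_betw f M N \<and> (\<forall>x\<in>M. \<forall>y\<in>M. E x y \<longleftrightarrow> F (f x) (f y)))"


section \<open>Second-order ZFC\<close>

definition Extensionality :: fm where
  "Extensionality = Forall 0 (Forall 1 (Imp (Forall 2 (Iff (Mem 2 0) (Mem 2 1))) (Eq 0 1)))"

definition Foundation :: fm where
  "Foundation = Forall 0 (Imp (Exists 1 (Mem 1 0))
     (Exists 1 (And (Mem 1 0) (Neg (Exists 2 (And (Mem 2 1) (Mem 2 0)))))))"

definition Pairing :: fm where
  "Pairing = Forall 0 (Forall 1 (Exists 2 (Forall 3 (Iff (Mem 3 2) (Or (Eq 3 0) (Eq 3 1))))))"

definition Union_Axiom :: fm where
  "Union_Axiom = Forall 0 (Exists 1 (Forall 2 (Iff (Mem 2 1) (Exists 3 (And (Mem 3 0) (Mem 2 3))))))"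

definition Power_Set :: fm where
  "Power_Set = Forall 0 (Exists 1 (Forall 2 (Iff (Mem 2 1) (Forall 3 (Imp (Mem 3 2) (Mem 3 0))))))"

definition Infinity :: fm where
  "Infinity = Exists 0 (And
     (Exists 1 (And (Mem 1 0) (Forall 2 (Neg (Mem 2 1)))))
     (Forall 1 (Imp (Mem 1 0)
        (Exists 2 (And (Mem 2 0) (Forall 3 (Iff (Mem 3 2) (Or (Mem 3 1) (Eq 3 1)))))))))"

definition Separation2 :: fm where
  "Separation2 = Forall2 1 0 (Forall 0 (Exists 1 (Forall 2 (Iff (Mem 2 1) (And (Mem 2 0) (Rel 0 [2]))))))"

definition Replacement2 :: fm where
  "Replacement2 = Forall2 2 0 (Imp
     (Forall 0 (Forall 1 (Forall 2 (Imp (And (Rel 0 [0, 1]) (Rel 0 [0, 2])) (Eq 1 2)))))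
     (Forall 0 (Exists 1 (Forall 2 (Iff (Mem 2 1) (Exists 3 (And (Mem 3 0) (Rel 0 [3, 2]))))))))"

text \<open>Every set of nonempty pairwise disjoint sets has a transversal.\<close>

definition Choice :: fm where
  "Choice = Forall 0 (Imp
     (And
       (Forall 1 (Imp (Mem 1 0) (Exists 2 (Mem 2 1))))
       (Forall 1 (Forall 2 (Imp (And (Mem 1 0) (And (Mem 2 0) (Exists 3 (And (Mem 3 1) (Mem 3 2))))) (Eq 1 2)))))
     (Exists 1 (Forall 2 (Imp (Mem 2 0)
       (Exists 3 (Forall 4 (Iff (And (Mem 4 2) (Mem 4 1)) (Eq 4 3))))))))"

definition ZFC2 :: "fm set" where
  "ZFC2 = {Extensionality, Foundation, Pairing, Union_Axiom, Power_Set, Infinity,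
           Separation2, Replacement2, Choice}"

lemma ZFC2_sentences: "\<forall>\<sigma>\<in>ZFC2. sentence \<sigma>"
  by (auto simp: ZFC2_def sentence_def Extensionality_def Foundation_def Pairing_def
      Union_Axiom_def Power_Set_def Infinity_def Separation2_def Replacement2_def Choice_def)

text \<open>
  Inside the universe \<open>U\<close>, the theory ZFC2 + \<open>\<Sigma>\<close> has the rank-initial segment at \<open>\<kappa>\<close> as its
  unique model up to isomorphism. Here \<open>U\<close> is the whole universe or \<open>Vset \<theta>\<close> with \<open>\<theta>\<close> inaccessible.
  Such a \<open>U\<close> contains all relations on and all functions between its elements, so \<open>E\<close>, the
  isomorphism and the second-order quantifiers need no separate restriction to \<open>U\<close>.
\<close>

definition categorically_characterizes_in ::
  "'v::zfc_universe set \<Rightarrow> fm set \<Rightarrow> 'v \<Rightarrow> bool" where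
  "categorically_characterizes_in U \<Sigma> \<kappa> \<longleftrightarrow>
     (\<exists>v\<in>U. elts v = Vset \<kappa>) \<and> models (Vset \<kappa>) mem (ZFC2 \<union> \<Sigma>) \<and>
     (\<forall>m\<in>U. \<forall>E. models (elts m) E (ZFC2 \<union> \<Sigma>) \<longrightarrow> isomorphic (elts m) E (Vset \<kappa>) mem)"

end

theory Submission
  imports Defs
begin

text \<open>
  The core is Zermelo's quasi-categoricity theorem. In a set-sized model of ZFC2 the membership
  relation is well-founded, since the range of a descending sequence would be a set of the model by
  second-order replacement. Its Mostowski collapse is a transitive set closed under subsets, power
  sets, unions and images, that is, a Grothendieck universe; such a set is the rank-initial segment
  at its set of ordinals, which is inaccessible. Hence ZFC2 + \<open>\<Sigma>\<close> is categorical in a universe as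
  soon as only one inaccessible \<open>\<kappa>\<close> in it satisfies \<open>\<Sigma>\<close> at its rank-initial segment. If there
  are several such cardinals, take the least one as \<open>\<kappa>'\<close> and the second one as \<open>\<theta>\<close>.
\<close>

text \<open>A model carries an arbitrary relation, inaccessibility speaks of cardinalities, and
  \<open>Vset\<close> speaks of ordinals. What links the three is limitation of size: second-order
  replacement admits every HOL function, so a collection of elements that is no larger than the
  extent of one element is itself an extent. This holds in an abstract model, in the background
  universe and in a Grothendieck universe. Grothendieck universes stand in the middle because their
  closure conditions mention neither ordinals nor ranks: they can be read off from a transitive
  model, and they suffice to verify the axioms. The way from an inaccessible \<kappa> to such a
  universe costs one cardinal computation, that the stages below \<kappa> have size below \<kappa>.
  A model whose carrier lies in \<open>Vset \<theta>\<close> is collapsed in the whole universe, so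
  nothing yet puts the resulting inaccessible below \<theta>; comparing sizes does.\<close>

lemma lepoll_linear: "A \<lesssim> B \<or> B \<lesssim> A"
  unfolding lepoll_def card_of_ordLeq
  by (rule ordLeq_total) (simp_all add: card_of_Well_order)

lemma lepoll_UNION:
  assumes "infinite B" "I \<lesssim> B" "\<And>i. i \<in> I \<Longrightarrow> A i \<lesssim> B"
  shows "(\<Union>i\<in>I. A i) \<lesssim> B"
  using assms unfolding lepoll_def card_of_ordLeq by (simp add: card_of_UNION_ordLeq_infinite)

lemma lepoll_Pow_mono:
  assumes "A \<lesssim> B"
  shows "Pow A \<lesssim> Pow B"
proof -
  obtain g where g: "A \<subseteq> g ` B"
    using assms unfolding lepoll_iff by blast
  have "X \<in> (`) g ` Pow B" if "X \<subseteq> A" for X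
  proof
    show "X = g ` {b \<in> B. g b \<in> X}" using that g by blast
  qed blast
  then have "Pow A \<subseteq> (`) g ` Pow B"
    by blast
  then show ?thesis
    unfolding lepoll_iff by blast
qed


section \<open>Structures for second-order set theory\<close>

text \<open>The second-order quantifiers of \<open>Separation2\<close> and
  \<open>Replacement2\<close> turn into arbitrary HOL predicates \<open>P\<close> and
  \<open>Q\<close>, which under full semantics range over the same relations. Choice is kept apart,
  so that the axioms of the class alone make the background universe an instance.\<close>

locale zf_structure =
  fixes M :: "'m set" and E :: "'m \<Rightarrow> 'm \<Rightarrow> bool"
  assumes nonempty: "M \<noteq> {}"
    and extensional:
      "\<lbrakk>x \<in> M; y \<in> M; \<And>z. z \<in> M \<Longrightarrow> E z x \<longleftrightarrow> E z y\<rbrakk> \<Longrightarrow> x = y"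
    and founded:
      "\<lbrakk>x \<in> M; y \<in> M; E y x\<rbrakk> \<Longrightarrow> \<exists>y\<in>M. E y x \<and> \<not> (\<exists>z\<in>M. E z y \<and> E z x)"
    and pair: "\<lbrakk>x \<in> M; y \<in> M\<rbrakk> \<Longrightarrow> \<exists>z\<in>M. \<forall>u\<in>M. E u z \<longleftrightarrow> u = x \<or> u = y"
    and union: "x \<in> M \<Longrightarrow> \<exists>u\<in>M. \<forall>z\<in>M. E z u \<longleftrightarrow> (\<exists>y\<in>M. E y x \<and> E z y)"
    and power: "x \<in> M \<Longrightarrow> \<exists>p\<in>M. \<forall>z\<in>M. E z p \<longleftrightarrow> (\<forall>y\<in>M. E y z \<longrightarrow> E y x)"
    and infinity: "\<exists>w\<in>M. (\<exists>e\<in>M. E e w \<and> (\<forall>z\<in>M. \<not> E z e)) \<and>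
      (\<forall>y\<in>M. E y w \<longrightarrow> (\<exists>z\<in>M. E z w \<and> (\<forall>u\<in>M. E u z \<longleftrightarrow> E u y \<or> u = y)))"
    and separation: "x \<in> M \<Longrightarrow> \<exists>b\<in>M. \<forall>z\<in>M. E z b \<longleftrightarrow> E z x \<and> P z"
    and replacement:
      "\<lbrakk>\<And>x y z. \<lbrakk>x \<in> M; y \<in> M; z \<in> M; Q x y; Q x z\<rbrakk> \<Longrightarrow> y = z; x \<in> M\<rbrakk>
        \<Longrightarrow> \<exists>b\<in>M. \<forall>z\<in>M. E z b \<longleftrightarrow> (\<exists>y\<in>M. E y x \<and> Q y z)"

definition choice_structure :: "'m set \<Rightarrow> ('m \<Rightarrow> 'm \<Rightarrow> bool) \<Rightarrow> bool" where
  "choice_structure M E \<longleftrightarrow> (\<forall>x\<in>M.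
     (\<forall>y\<in>M. E y x \<longrightarrow> (\<exists>z\<in>M. E z y)) \<and>
     (\<forall>y\<in>M. \<forall>z\<in>M. E y x \<and> E z x \<and> (\<exists>u\<in>M. E u y \<and> E u z) \<longrightarrow> y = z) \<longrightarrow>
     (\<exists>t\<in>M. \<forall>y\<in>M. E y x \<longrightarrow> (\<exists>z\<in>M. \<forall>u\<in>M. E u y \<and> E u t \<longleftrightarrow> u = z)))"

text \<open>A set of one-element lists over \<open>M\<close> is the same as a predicate restricted
  to \<open>M\<close>. This replaces the list encoding of a unary relation variable by a HOL
  predicate.\<close>

lemma ball_relations_1:
  "(\<forall>A\<in>relations M 1. \<Phi> A) \<longleftrightarrow> (\<forall>P. \<Phi> {[x] |x. x \<in> M \<and> P x})"
proof safe
  fix P assume "\<forall>A\<in>relations M 1. \<Phi> A"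
  then show "\<Phi> {[x] |x. x \<in> M \<and> P x}"
    by (rule bspec) (auto simp: relations_def)
next
  fix A assume *: "\<forall>P. \<Phi> {[x] |x. x \<in> M \<and> P x}" and "A \<in> relations M 1"
  then have "A = {[x] |x. x \<in> M \<and> [x] \<in> A}"
    by (auto simp: relations_def length_Suc_conv)
  then show "\<Phi> A"
    using *[rule_format, of "\<lambda>x. [x] \<in> A"] by simp
qed

lemma ball_relations_2:
  "(\<forall>A\<in>relations M 2. \<Phi> A) \<longleftrightarrow> (\<forall>Q. \<Phi> {[x, y] |x y. x \<in> M \<and> y \<in> M \<and> Q x y})"
proof safe
  fix Q assume "\<forall>A\<in>relations M 2. \<Phi> A"
  then show "\<Phi> {[x, y] |x y. x \<in> M \<and> y \<in> M \<and> Q x y}"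
    by (rule bspec) (auto simp: relations_def)
next
  fix A assume *: "\<forall>Q. \<Phi> {[x, y] |x y. x \<in> M \<and> y \<in> M \<and> Q x y}" and "A \<in> relations M 2"
  then have "A = {[x, y] |x y. x \<in> M \<and> y \<in> M \<and> [x, y] \<in> A}"
    by (auto simp: relations_def length_Suc_conv numeral_2_eq_2)
  then show "\<Phi> A"
    using *[rule_format, of "\<lambda>x y. [x, y] \<in> A"] by simp
qed

text \<open>Formulas are built from \<open>Neg\<close>, \<open>And\<close> and \<open>Forall\<close>
  only. These equations bring back implication, disjunction, equivalence and existence, so that
  evaluating an axiom yields its usual wording.\<close>

lemma connective_simps:
  "\<not> (P \<and> \<not> Q) \<longleftrightarrow> (P \<longrightarrow> Q)" "(\<not> P \<longrightarrow> Q) \<longleftrightarrow> P \<or> Q"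
  "(P \<longrightarrow> Q) \<and> (Q \<longrightarrow> P) \<longleftrightarrow> (P \<longleftrightarrow> Q)"
  "\<not> (\<forall>x\<in>M. \<not> R x) \<longleftrightarrow> (\<exists>x\<in>M. R x)"
  by blast+

lemmas sat_eval = connective_simps sat.simps fun_upd_apply rel_simps zero_neq_one one_neq_zero
  if_True if_False simp_thms

section \<open>Evaluation of the axioms of \<open>ZFC2\<close> in a structure\<close>

lemma sat_Extensionality:
  "sat M E s r Extensionality \<longleftrightarrow>
    (\<forall>x\<in>M. \<forall>y\<in>M. (\<forall>z\<in>M. E z x \<longleftrightarrow> E z y) \<longrightarrow> x = y)"
  unfolding Extensionality_def by (simp only: sat_eval)

lemma sat_Foundation:
  "sat M E s r Foundation \<longleftrightarrow>
    (\<forall>x\<in>M. (\<exists>y\<in>M. E y x) \<longrightarrow> (\<exists>y\<in>M. E y x \<and> \<not> (\<exists>z\<in>M. E z y \<and> E z x)))"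
  unfolding Foundation_def by (simp only: sat_eval) blast

lemma sat_Pairing:
  "sat M E s r Pairing \<longleftrightarrow>
    (\<forall>x\<in>M. \<forall>y\<in>M. \<exists>z\<in>M. \<forall>u\<in>M. E u z \<longleftrightarrow> u = x \<or> u = y)"
  unfolding Pairing_def by (simp only: sat_eval)

lemma sat_Union_Axiom:
  "sat M E s r Union_Axiom \<longleftrightarrow>
    (\<forall>x\<in>M. \<exists>u\<in>M. \<forall>z\<in>M. E z u \<longleftrightarrow> (\<exists>y\<in>M. E y x \<and> E z y))"
  unfolding Union_Axiom_def by (simp only: sat_eval)

lemma sat_Power_Set:
  "sat M E s r Power_Set \<longleftrightarrow>
    (\<forall>x\<in>M. \<exists>p\<in>M. \<forall>z\<in>M. E z p \<longleftrightarrow> (\<forall>y\<in>M. E y z \<longrightarrow> E y x))"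
  unfolding Power_Set_def by (simp only: sat_eval)

lemma sat_Infinity:
  "sat M E s r Infinity \<longleftrightarrow>
    (\<exists>w\<in>M. (\<exists>e\<in>M. E e w \<and> (\<forall>z\<in>M. \<not> E z e)) \<and>
      (\<forall>y\<in>M. E y w \<longrightarrow> (\<exists>z\<in>M. E z w \<and> (\<forall>u\<in>M. E u z \<longleftrightarrow> E u y \<or> u = y))))"
  unfolding Infinity_def by (simp only: sat_eval)

lemma sat_Separation2:
  "sat M E s r Separation2 \<longleftrightarrow>
    (\<forall>P. \<forall>x\<in>M. \<exists>b\<in>M. \<forall>z\<in>M. E z b \<longleftrightarrow> E z x \<and> P z)"
  unfolding Separation2_def sat.simps(7) ball_relations_1
  by (simp only: sat_eval list.map list.size One_nat_def numeral_2_eq_2 add_0 add_0_right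
      add_Suc_right nat.inject nat.distinct mem_Collect_eq list.inject ex_simps cong: ball_cong bex_cong)

lemma sat_Replacement2:
  "sat M E s r Replacement2 \<longleftrightarrow>
    (\<forall>Q. (\<forall>x\<in>M. \<forall>y\<in>M. \<forall>z\<in>M. Q x y \<and> Q x z \<longrightarrow> y = z) \<longrightarrow>
      (\<forall>x\<in>M. \<exists>b\<in>M. \<forall>z\<in>M. E z b \<longleftrightarrow> (\<exists>y\<in>M. E y x \<and> Q y z)))"
proof -
  \<comment> \<open>Membership of a two-element list in the comprehension that encodes
    \<open>Q\<close> unfolds to this existential form.\<close>
  have *: "(\<exists>x y. (a = x \<and> b = y) \<and> R x y) \<longleftrightarrow> R a b" for a b :: 'a and R
    by blast
  show ?thesis
    unfolding Replacement2_def sat.simps(7) ball_relations_2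
    by (simp only: sat_eval list.map list.size One_nat_def numeral_2_eq_2 numeral_3_eq_3 add_0
      add_0_right add_Suc_right nat.inject nat.distinct mem_Collect_eq list.inject *
      cong: ball_cong bex_cong)
qed

lemma sat_Choice: "sat M E s r Choice \<longleftrightarrow> choice_structure M E"
  unfolding Choice_def choice_structure_def by (simp only: sat_eval)

lemmas sat_ZFC2 = sat_Extensionality sat_Foundation sat_Pairing sat_Union_Axiom sat_Power_Set
  sat_Infinity sat_Separation2 sat_Replacement2 sat_Choice

text \<open>\<open>models\<close> quantifies over all assignments in \<open>M\<close>. If the truth
  value never depends on the assignment, a single one decides, even one with values outside
  \<open>M\<close>; below, \<open>undefined\<close> serves as that assignment.\<close>

lemma models_iff_if_sat_const:
  assumes "M \<noteq> {}" "\<And>\<phi> s r. \<phi> \<in> T \<Longrightarrow> sat M E s r \<phi> \<longleftrightarrow> sat M E s\<^sub>0 r\<^sub>0 \<phi>"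
  shows "models M E T \<longleftrightarrow> (\<forall>\<phi>\<in>T. sat M E s\<^sub>0 r\<^sub>0 \<phi>)"
proof
  assume *: "models M E T"
  obtain a where "a \<in> M" using assms(1) by blast
  \<comment> \<open>The empty relation is admissible at every arity, so this assignment is
    legitimate.\<close>
  then have "sat M E (\<lambda>_. a) (\<lambda>_. {}) \<phi>" if "\<phi> \<in> T" for \<phi>
    using * that by (simp add: models_def relations_def)
  then show "\<forall>\<phi>\<in>T. sat M E s\<^sub>0 r\<^sub>0 \<phi>"
    using assms(2) by blast
next
  assume "\<forall>\<phi>\<in>T. sat M E s\<^sub>0 r\<^sub>0 \<phi>"
  then show "models M E T"
    unfolding models_def using assms by blast
qed

lemma models_ZFC2_iff: "models M E ZFC2 \<longleftrightarrow> zf_structure M E \<and> choice_structure M E"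
proof (cases "M = {}")
  case True
  then show ?thesis
    by (simp add: models_def zf_structure_def)
next
  case False
  have "sat M E s r \<phi> \<longleftrightarrow> sat M E undefined undefined \<phi>" if "\<phi> \<in> ZFC2" for \<phi> s r
    using that unfolding ZFC2_def by (elim insertE emptyE; simp only: sat_ZFC2)
  then have "models M E ZFC2 \<longleftrightarrow> (\<forall>\<phi>\<in>ZFC2. sat M E undefined undefined \<phi>)"
    by (rule models_iff_if_sat_const[OF False])
  also have "\<dots> \<longleftrightarrow> zf_structure M E \<and> choice_structure M E"
  proof
    assume *: "\<forall>\<phi>\<in>ZFC2. sat M E undefined undefined \<phi>"
    have ax: "sat M E undefined undefined \<phi>" if "\<phi> \<in> ZFC2" for \<phi>
      using * that by blast
    have "zf_structure M E"
    proof
      show "M \<noteq> {}" by fact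
      show "x = y" if "x \<in> M" "y \<in> M" "\<And>z. z \<in> M \<Longrightarrow> E z x \<longleftrightarrow> E z y" for x y
        using ax[of Extensionality, unfolded sat_ZFC2] that by (simp add: ZFC2_def)
      show "\<exists>y\<in>M. E y x \<and> \<not> (\<exists>z\<in>M. E z y \<and> E z x)" if "x \<in> M" "y \<in> M" "E y x" for x y
        using ax[of Foundation, unfolded sat_ZFC2] that by (simp add: ZFC2_def) blast
      show "\<exists>z\<in>M. \<forall>u\<in>M. E u z \<longleftrightarrow> u = x \<or> u = y" if "x \<in> M" "y \<in> M" for x y
        using ax[of Pairing, unfolded sat_ZFC2] that by (simp add: ZFC2_def)
      show "\<exists>u\<in>M. \<forall>z\<in>M. E z u \<longleftrightarrow> (\<exists>y\<in>M. E y x \<and> E z y)" if "x \<in> M" for x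
        using ax[of Union_Axiom, unfolded sat_ZFC2] that by (simp add: ZFC2_def)
      show "\<exists>p\<in>M. \<forall>z\<in>M. E z p \<longleftrightarrow> (\<forall>y\<in>M. E y z \<longrightarrow> E y x)" if "x \<in> M" for x
        using ax[of Power_Set, unfolded sat_ZFC2] that by (simp add: ZFC2_def)
      show "\<exists>w\<in>M. (\<exists>e\<in>M. E e w \<and> (\<forall>z\<in>M. \<not> E z e)) \<and>
        (\<forall>y\<in>M. E y w \<longrightarrow> (\<exists>z\<in>M. E z w \<and> (\<forall>u\<in>M. E u z \<longleftrightarrow> E u y \<or> u = y)))"
        using ax[of Infinity, unfolded sat_ZFC2] by (simp add: ZFC2_def)
      show "\<exists>b\<in>M. \<forall>z\<in>M. E z b \<longleftrightarrow> E z x \<and> P z" if "x \<in> M" for x P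
        using ax[of Separation2, unfolded sat_ZFC2] that by (simp add: ZFC2_def)
      show "\<exists>b\<in>M. \<forall>z\<in>M. E z b \<longleftrightarrow> (\<exists>y\<in>M. E y x \<and> Q y z)"
        if "\<And>x y z. \<lbrakk>x \<in> M; y \<in> M; z \<in> M; Q x y; Q x z\<rbrakk> \<Longrightarrow> y = z" "x \<in> M" for x Q
      proof -
        have "\<forall>x\<in>M. \<forall>y\<in>M. \<forall>z\<in>M. Q x y \<and> Q x z \<longrightarrow> y = z"
          using that(1) by blast
        then show ?thesis
          using ax[of Replacement2, unfolded sat_ZFC2] that(2) by (simp add: ZFC2_def)
      qed
    qed
    moreover have "choice_structure M E"
      using ax[of Choice, unfolded sat_ZFC2] by (simp add: ZFC2_def)
    ultimately show "zf_structure M E \<and> choice_structure M E" ..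
  next
    assume *: "zf_structure M E \<and> choice_structure M E"
    then interpret zf_structure M E by simp
    have "sat M E undefined undefined Foundation"
      unfolding sat_Foundation by (meson founded)
    moreover have "sat M E undefined undefined Replacement2"
      unfolding sat_Replacement2 by (intro allI impI ballI replacement) blast+
    moreover have "sat M E undefined undefined Extensionality"
      unfolding sat_Extensionality by (intro ballI impI extensional) blast+
    ultimately show "\<forall>\<phi>\<in>ZFC2. sat M E undefined undefined \<phi>"
      using * by (simp add: ZFC2_def sat_Pairing sat_Union_Axiom sat_Power_Set
          sat_Infinity sat_Separation2 sat_Choice pair union power infinity separation)
  qed
  finally show ?thesis .
qed

section \<open>Limitation of size and well-foundedness in a model\<close>

context zf_structure
begin

definition extent :: "'m \<Rightarrow> 'm set" where
  "extent x = {y \<in> M. E y x}"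

text \<open>Foundation for the singleton of \<open>x\<close>. Irreflexivity is needed before
  well-foundedness is available, to make the successor chain below injective.\<close>

lemma not_self:
  assumes "x \<in> M"
  shows "\<not> E x x"
proof -
  obtain z where "z \<in> M" "\<forall>u\<in>M. E u z \<longleftrightarrow> u = x"
    using pair[OF assms assms] by auto
  then show ?thesis
    using founded[of z x] assms by auto
qed

text \<open>Iterated successors inside the witness of infinity form a chain in which every earlier
  term is a member of every later one; by irreflexivity the terms are distinct.\<close>

lemma infinite_extent: "\<exists>w\<in>M. infinite (extent w)"
proof -
  obtain w e where w: "w \<in> M" and e: "e \<in> M" "E e w"
    and suc: "\<forall>y\<in>M. E y w \<longrightarrow> (\<exists>z\<in>M. E z w \<and> (\<forall>u\<in>M. E u z \<longleftrightarrow> E u y \<or> u = y))"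
    using infinity by blast
  have "\<exists>a. \<forall>n::nat. (a n \<in> M \<and> E (a n) w) \<and> (\<forall>u\<in>M. E u (a (Suc n)) \<longleftrightarrow> E u (a n) \<or> u = a n)"
    by (rule dependent_nat_choice) (use e suc in auto)
  then obtain a where a: "\<And>n::nat. a n \<in> M \<and> E (a n) w"
    and a_Suc: "\<And>n u. u \<in> M \<Longrightarrow> E u (a (Suc n)) \<longleftrightarrow> E u (a n) \<or> u = a n"
    by blast
  have less: "E (a m) (a n)" if "m < n" for m n
    using that by (induction n) (auto simp: a a_Suc less_Suc_eq)
  have "inj a"
    using less not_self[OF conjunct1[OF a]] by (intro linorder_injI) (metis (full_types))
  moreover have "range a \<subseteq> extent w"
    using a by (auto simp: extent_def)
  ultimately show ?thesis
    using w by (meson infinite_iff_countable_subset)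
qed

text \<open>Limitation of size in the model. The covering map \<open>g\<close> is an arbitrary HOL
  function, which is where the second-order form of replacement is essential.\<close>

lemma image_extent:
  assumes "x \<in> M" "A \<subseteq> M" "A \<lesssim> extent x"
  shows "\<exists>b\<in>M. extent b = A"
proof -
  obtain g where g: "A \<subseteq> g ` extent x"
    using assms(3) unfolding lepoll_iff by blast
  \<comment> \<open>The values of \<open>g\<close> may overshoot \<open>A\<close>; the conjunct
    \<open>z \<in> A\<close> discards the surplus within the same instance of replacement.\<close>
  obtain b where "b \<in> M" "\<forall>z\<in>M. E z b \<longleftrightarrow> (\<exists>y\<in>M. E y x \<and> z = g y \<and> z \<in> A)"
    using replacement[of "\<lambda>y z. z = g y \<and> z \<in> A" x] assms(1) by auto
  then have "extent b = A"
    using g assms(2) unfolding extent_def by blast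
  with \<open>b \<in> M\<close> show ?thesis ..
qed

lemma wf_membership: "wf {(y, x). y \<in> M \<and> x \<in> M \<and> E y x}"
  unfolding wf_iff_no_infinite_down_chain
proof
  assume "\<exists>a. \<forall>i. (a (Suc i), a i) \<in> {(y, x). y \<in> M \<and> x \<in> M \<and> E y x}"
  then obtain a where a: "\<And>i::nat. a i \<in> M" "\<And>i. E (a (Suc i)) (a i)"
    by auto
  obtain w where "w \<in> M" "infinite (extent w)"
    using infinite_extent by blast
  \<comment> \<open>The range of a sequence is countable, so any infinite extent is large enough to
    cover it.\<close>
  moreover from this have "range a \<lesssim> extent w"
    by (meson image_lepoll infinite_le_lepoll lepoll_trans)
  ultimately obtain b where b: "b \<in> M" "extent b = range a"
    using image_extent[of w "range a"] a by blast
  then have "E (a 0) b"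
    by (auto simp: extent_def)
  then obtain y where "y \<in> M" "E y b" "\<not> (\<exists>z\<in>M. E z y \<and> E z b)"
    using founded[of b "a 0"] b a by blast
  moreover from this obtain i where "y = a i"
    using b by (auto simp: extent_def)
  moreover have "E (a (Suc i)) b"
    using b(2) a by (auto simp: extent_def)
  ultimately show False
    using a by blast
qed

end


section \<open>The background universe\<close>

text \<open>Transfers the facts proved for models to the background: membership is irreflexive and
  well-founded, and limitation of size holds for genuine sets.\<close>

interpretation universe: zf_structure "UNIV :: 'v::zfc_universe set" mem
proof
  fix x y :: 'v
  show "x = y" if "\<And>z. z \<in> UNIV \<Longrightarrow> mem z x \<longleftrightarrow> mem z y"
    by (rule extensionality_ax, rule set_eqI, rule that, rule UNIV_I)
  show "\<exists>y\<in>UNIV. mem y x \<and> \<not> (\<exists>z\<in>UNIV. mem z y \<and> mem z x)" if "mem y x"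
    using foundation_ax[of x] that by blast
  obtain z where z: "elts z = {x, y}"
    using pairing_ax[of x y] by blast
  show "\<exists>z\<in>UNIV. \<forall>u\<in>UNIV. mem u z \<longleftrightarrow> u = x \<or> u = y"
    by (rule bexI[of _ z]) (simp_all add: z)
  obtain u where u: "elts u = (\<Union>y\<in>elts x. elts y)"
    using union_ax[of x] by blast
  show "\<exists>u\<in>UNIV. \<forall>z\<in>UNIV. mem z u \<longleftrightarrow> (\<exists>y\<in>UNIV. mem y x \<and> mem z y)"
    by (rule bexI[of _ u]) (simp_all add: u Bex_def)
  obtain p where p: "elts p = {z. elts z \<subseteq> elts x}"
    using power_ax[of x] by blast
  show "\<exists>p\<in>UNIV. \<forall>z\<in>UNIV. mem z p \<longleftrightarrow> (\<forall>y\<in>UNIV. mem y z \<longrightarrow> mem y x)"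
    by (rule bexI[of _ p]) (simp_all add: p subset_iff)
  show "\<exists>b\<in>UNIV. \<forall>z\<in>UNIV. mem z b \<longleftrightarrow> mem z x \<and> P z" for P
  proof -
    obtain b where b: "elts b = {z \<in> elts x. P z}"
      using separation_ax[of x P] by blast
    show ?thesis
      by (rule bexI[of _ b]) (simp_all add: b)
  qed
  show "\<exists>b\<in>UNIV. \<forall>z\<in>UNIV. mem z b \<longleftrightarrow> (\<exists>y\<in>UNIV. mem y x \<and> Q y z)"
    if Q: "\<And>x y z. \<lbrakk>x \<in> UNIV; y \<in> UNIV; z \<in> UNIV; Q x y; Q x z\<rbrakk> \<Longrightarrow> y = z" for Q :: "'v \<Rightarrow> 'v \<Rightarrow> bool"
  proof -
    \<comment> \<open>\<open>replacement_ax\<close> takes a total function, whereas \<open>Q\<close>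
      may be partial. Cutting \<open>x\<close> down to the domain of \<open>Q\<close> keeps junk
      values of \<open>F\<close> out of the image.\<close>
    obtain a where a: "elts a = {y \<in> elts x. \<exists>z. Q y z}"
      using separation_ax[of x "\<lambda>y. \<exists>z. Q y z"] by blast
    define F where "F y = (THE z. Q y z)" for y
    obtain b where b: "elts b = F ` elts a"
      using replacement_ax[of F a] by blast
    have "F y = z" if "Q y z" for y z
      unfolding F_def
    proof (rule the_equality)
      show "u = z" if "Q y u" for u
        using Q[of y u z] that \<open>Q y z\<close> by simp
    qed fact
    then have "mem z b \<longleftrightarrow> (\<exists>y. mem y x \<and> Q y z)" for z
      unfolding a b by auto
    then show ?thesis
      by (intro bexI[of _ b] ballI) simp_all
  qed
next
  obtain w :: 'v where w: "\<exists>e\<in>elts w. elts e = {}"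
    "\<forall>y\<in>elts w. \<exists>z\<in>elts w. elts z = insert y (elts y)"
    using infinity_ax by blast
  have "\<exists>e\<in>UNIV. mem e w \<and> (\<forall>z\<in>UNIV. \<not> mem z e)"
    using w(1) by (metis empty_iff UNIV_I)
  moreover have "\<exists>z\<in>UNIV. mem z w \<and> (\<forall>u\<in>UNIV. mem u z \<longleftrightarrow> mem u y \<or> u = y)"
    if "mem y w" for y
    using w(2) that by (metis UNIV_I insert_iff)
  ultimately show "\<exists>w\<in>(UNIV :: 'v set). (\<exists>e\<in>UNIV. mem e w \<and> (\<forall>z\<in>UNIV. \<not> mem z e)) \<and>
      (\<forall>y\<in>UNIV. mem y w \<longrightarrow> (\<exists>z\<in>UNIV. mem z w \<and> (\<forall>u\<in>UNIV. mem u z \<longleftrightarrow> mem u y \<or> u = y)))"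
    by (intro bexI[of _ w]) simp_all
qed simp

lemma wf_mem: "wf {(y, x :: 'v::zfc_universe). mem y x}"
  using universe.wf_membership by simp

lemma mem_induct [case_names step]:
  assumes "\<And>x :: 'v::zfc_universe. (\<And>y. mem y x \<Longrightarrow> P y) \<Longrightarrow> P x"
  shows "P a"
  using wf_induct[OF wf_mem, of P a] assms by auto

lemma not_mem_self: "\<not> mem x (x :: 'v::zfc_universe)"
  by (simp add: universe.not_self)

lemma lepoll_elts_imp_set:
  assumes "A \<lesssim> elts (x :: 'v::zfc_universe)"
  shows "\<exists>s::'v. elts s = A"
  using universe.image_extent[of x A] assms by (simp add: universe.extent_def)

lemma subset_elts_imp_set: "A \<subseteq> elts (x :: 'v::zfc_universe) \<Longrightarrow> \<exists>s::'v. elts s = A"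
  by (rule lepoll_elts_imp_set[OF subset_imp_lepoll])

lemma Union_image_set:
  "\<exists>s::'v::zfc_universe. elts s = (\<Union>y\<in>elts (x::'v). elts (f y))"
proof -
  obtain b :: 'v where b: "elts b = f ` elts x"
    using replacement_ax[of f x] by blast
  show ?thesis
    using union_ax[of b] unfolding b by simp
qed

lemma successor_exists: "\<exists>z::'v::zfc_universe. elts z = insert y (elts y)"
proof -
  obtain s :: 'v where s: "elts s = {y}"
    using pairing_ax[of y y] by auto
  obtain t where t: "elts t = {y, s}"
    using pairing_ax[of y s] by auto
  show ?thesis
    using union_ax[of t] t s by simp
qed

text \<open>Well-founded recursion: the value at \<open>x\<close> is the set of the values at the
  predecessors of \<open>x\<close>, which exists by replacement because the predecessors form a set.
  Points without predecessors go to the empty set, so no carrier has to be mentioned.\<close>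

lemma mostowski_collapse:
  fixes R :: "('v::zfc_universe \<times> 'v) set"
  assumes "wf R" and set_like: "\<And>x. \<exists>s. elts s = {y. (y, x) \<in> R}"
  shows "\<exists>c :: 'v \<Rightarrow> 'v. \<forall>x. elts (c x) = c ` {y. (y, x) \<in> R}"
proof -
  define F where "F f x = (SOME s :: 'v. elts s = f ` {y. (y, x) \<in> R})" for f :: "'v \<Rightarrow> 'v" and x
  have F: "elts (F f x) = f ` {y. (y, x) \<in> R}" for f x
  proof -
    have "\<exists>s. elts s = f ` {y. (y, x) \<in> R}"
      using set_like[of x] replacement_ax[of f] by metis
    then show ?thesis
      unfolding F_def by (rule someI_ex)
  qed
  have "wfrec R F x = F (cut (wfrec R F) R x) x" for x
    using \<open>wf R\<close> by (rule wfrec)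
  then have "elts (wfrec R F x) = cut (wfrec R F) R x ` {y. (y, x) \<in> R}" for x
    by (simp add: F)
  \<comment> \<open>\<open>cut\<close> alters the function only off the predecessors of
    \<open>x\<close>, and the image looks at nothing else.\<close>
  also have "cut (wfrec R F) R x ` {y. (y, x) \<in> R} = wfrec R F ` {y. (y, x) \<in> R}" for x
    by (intro image_cong) (auto simp: cut_apply)
  finally show ?thesis
    by (intro exI[of _ "wfrec R F"] allI)
qed

text \<open>If \<open>c x = c y\<close>, each predecessor of one point has the same collapse as some
  predecessor of the other. By induction the two predecessors coincide, and extensionality of
  \<open>R\<close> gives \<open>x = y\<close>.\<close>

lemma collapse_inj_on:
  fixes R :: "('v::zfc_universe \<times> 'v) set"
  assumes "wf R" and c: "\<And>x. elts (c x) = c ` {y. (y, x) \<in> R}"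
    and R: "R \<subseteq> A \<times> A"
    and ext: "\<And>x y. \<lbrakk>x \<in> A; y \<in> A; \<And>z. (z, x) \<in> R \<longleftrightarrow> (z, y) \<in> R\<rbrakk> \<Longrightarrow> x = y"
  shows "inj_on c A"
proof -
  have "x \<in> A \<Longrightarrow> \<forall>y\<in>A. c x = c y \<longrightarrow> x = y" for x
    using \<open>wf R\<close>
  proof (induction x rule: wf_induct_rule)
    case (less x)
    show ?case
    proof (intro ballI impI)
      fix y assume y: "y \<in> A" "c x = c y"
      then have im: "c ` {z. (z, x) \<in> R} = c ` {z. (z, y) \<in> R}"
        using c by metis
      have "(z, y) \<in> R" if z: "(z, x) \<in> R" for z
      proof -
        obtain u where u: "(u, y) \<in> R" "c z = c u"
          using im z by blast
        moreover have "z \<in> A" "u \<in> A"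
          using R z u by auto
        ultimately have "z = u"
          using less.IH[OF z] by blast
        with u show ?thesis by simp
      qed
      moreover have "(z, x) \<in> R" if z: "(z, y) \<in> R" for z
      proof -
        \<comment> \<open>The induction hypothesis covers predecessors of \<open>x\<close> only, so
          here it is applied to \<open>u\<close> and not to \<open>z\<close>.\<close>
        obtain u where u: "(u, x) \<in> R" "c u = c z"
          using im z by (metis (no_types, lifting) imageE image_eqI mem_Collect_eq)
        moreover have "z \<in> A" "u \<in> A"
          using R z u by auto
        ultimately have "u = z"
          using less.IH[OF u(1)] by blast
        with u show ?thesis by simp
      qed
      ultimately show "x = y"
        using ext less.prems y by blast
    qed
  qed
  then show ?thesis
    by (auto simp: inj_on_def)
qed


section \<open>Ordinals and the cumulative hierarchy\<close>

lemma ordinal_mem: "ordinal \<alpha> \<Longrightarrow> mem \<beta> \<alpha> \<Longrightarrow> ordinal \<beta>"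
  unfolding ordinal_def transitive_set_def by blast

lemma ordinal_trans: "ordinal \<alpha> \<Longrightarrow> mem \<beta> \<alpha> \<Longrightarrow> mem \<gamma> \<beta> \<Longrightarrow> mem \<gamma> \<alpha>"
  unfolding ordinal_def transitive_set_def by blast

lemma ordinalI:
  "\<lbrakk>\<And>\<beta>. mem \<beta> \<alpha> \<Longrightarrow> ordinal \<beta>; \<And>\<beta> \<gamma>. \<lbrakk>mem \<beta> \<alpha>; mem \<gamma> \<beta>\<rbrakk> \<Longrightarrow> mem \<gamma> \<alpha>\<rbrakk> \<Longrightarrow> ordinal \<alpha>"
  unfolding ordinal_def transitive_set_def by blast

text \<open>Nested induction. If \<alpha> and \<beta> were incomparable, the outer hypothesis would
  put every member of \<alpha> into \<beta>, and the inner one every member of \<beta> into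
  \<alpha>, so they would be equal.\<close>

lemma ordinal_linear:
  fixes \<alpha> \<beta> :: "'v::zfc_universe"
  shows "\<lbrakk>ordinal \<alpha>; ordinal \<beta>\<rbrakk> \<Longrightarrow> mem \<alpha> \<beta> \<or> \<alpha> = \<beta> \<or> mem \<beta> \<alpha>"
proof (induction \<alpha> arbitrary: \<beta> rule: mem_induct)
  case (step \<alpha>)
  note IH1 = step.IH and \<alpha> = step.prems(1)
  show ?case
    using step.prems(2)
  proof (induction \<beta> rule: mem_induct)
    case (step \<beta>)
    show ?case
    proof (rule ccontr)
      assume neg: "\<not> ?case"
      have "mem \<gamma> \<beta>" if "mem \<gamma> \<alpha>" for \<gamma>
        using IH1[OF that ordinal_mem[OF \<alpha> that] step.prems] neg that ordinal_trans[OF \<alpha>] by blast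
      moreover have "mem \<gamma> \<alpha>" if "mem \<gamma> \<beta>" for \<gamma>
        using step.IH[OF that ordinal_mem[OF step.prems that]] neg that ordinal_trans[OF step.prems]
        by blast
      ultimately have "elts \<alpha> = elts \<beta>" by blast
      then show False
        using neg extensionality_ax by blast
    qed
  qed
qed

lemma ordinal_mem_or_subset:
  fixes \<alpha> \<beta> :: "'v::zfc_universe"
  shows "\<lbrakk>ordinal \<alpha>; ordinal \<beta>\<rbrakk> \<Longrightarrow> mem \<alpha> \<beta> \<or> elts \<beta> \<subseteq> elts \<alpha>"
  using ordinal_linear ordinal_trans by blast

text \<open>Turns a strict cardinal inequality into domination by a member of \<kappa>, the form in
  which \<open>regular\<close> can be applied. \<open>B\<close> is copied to a set \<open>A\<close>
  of ordinals below \<kappa>, whose collapse is its order type \<alpha>. As \<alpha> is equipollent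
  to \<open>B\<close>, it cannot include \<kappa>, hence it belongs to \<kappa>.\<close>

lemma lesspoll_ordinal_imp_lepoll_mem:
  fixes \<kappa> :: "'v::zfc_universe"
  assumes "ordinal \<kappa>" "B \<prec> elts \<kappa>"
  shows "\<exists>\<alpha>\<in>elts \<kappa>. B \<lesssim> elts \<alpha>"
proof -
  obtain f where f: "inj_on f B" "f ` B \<subseteq> elts \<kappa>"
    using assms(2) unfolding lesspoll_def lepoll_def by blast
  define A where "A = f ` B"
  define R where "R = {(y, x). y \<in> A \<and> x \<in> A \<and> mem y x}"
  have A: "A \<subseteq> elts \<kappa>" "B \<approx> A"
    using f by (auto simp: A_def eqpoll_def bij_betw_def)
  have ordA: "ordinal x" if "x \<in> A" for x
    using that A assms(1) ordinal_mem by blast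
  have wf: "wf R"
    by (rule wf_subset[OF wf_mem]) (auto simp: R_def)
  have set_like: "\<exists>s. elts s = {y. (y, x) \<in> R}" for x
    by (rule subset_elts_imp_set[of _ x]) (auto simp: R_def)
  obtain c :: "'v \<Rightarrow> 'v" where c: "\<And>x. elts (c x) = c ` {y. (y, x) \<in> R}"
    using mostowski_collapse[OF wf set_like] by blast
  have inj: "inj_on c A"
  proof (rule collapse_inj_on[OF wf c])
    show "x = y" if "x \<in> A" "y \<in> A" "\<And>z. (z, x) \<in> R \<longleftrightarrow> (z, y) \<in> R" for x y
      \<comment> \<open>Membership restricted to \<open>A\<close> is extensional: of two distinct
        ordinals one is a member of the other, hence an \<open>R\<close>-predecessor of it but not
        of itself.\<close>
      using ordinal_linear[OF ordA[OF that(1)] ordA[OF that(2)]] that(1,2) that(3)[of x] that(3)[of y]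
        not_mem_self
      by (auto simp: R_def)
  qed (auto simp: R_def)
  have ordc: "x \<in> A \<Longrightarrow> ordinal (c x)" for x
  proof (induction x rule: mem_induct)
    case (step x)
    show ?case
    proof (rule ordinalI)
      show "ordinal \<beta>" if "mem \<beta> (c x)" for \<beta>
        using that step.IH unfolding c by (auto simp: R_def)
      show "mem \<gamma> (c x)" if \<beta>: "mem \<beta> (c x)" and \<gamma>: "mem \<gamma> \<beta>" for \<beta> \<gamma>
      proof -
        obtain y where y: "y \<in> A" "mem y x" "\<beta> = c y"
          using \<beta> unfolding c by (auto simp: R_def)
        obtain z where z: "z \<in> A" "mem z y" "\<gamma> = c z"
          using \<gamma> unfolding y(3) c by (auto simp: R_def)
        have "mem z x"
          using ordinal_trans[OF ordA[OF step.prems]] y z by blast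
        then show ?thesis
          unfolding c using z step.prems by (auto simp: R_def)
      qed
    qed
  qed
  obtain s where s: "elts s = A"
    using subset_elts_imp_set[OF A(1)] by blast
  obtain \<alpha> where \<alpha>: "elts \<alpha> = c ` A"
    using replacement_ax[of c s] s by auto
  have "ordinal \<alpha>"
  proof (rule ordinalI)
    show "ordinal \<beta>" if "mem \<beta> \<alpha>" for \<beta>
      using that ordc \<alpha> by auto
    show "mem \<gamma> \<alpha>" if \<beta>: "mem \<beta> \<alpha>" and \<gamma>: "mem \<gamma> \<beta>" for \<beta> \<gamma>
    proof -
      obtain y where "\<beta> = c y" using \<beta> \<alpha> by auto
      then show ?thesis using \<gamma> \<alpha> by (auto simp: c R_def)
    qed
  qed
  have "B \<approx> elts \<alpha>"
    unfolding \<alpha> using A(2) inj by (simp add: inj_on_image_eqpoll_2)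
  then have "\<not> elts \<kappa> \<subseteq> elts \<alpha>"
    using lesspoll_trans2[OF assms(2) subset_imp_lepoll] lesspoll_def by blast
  then have "mem \<alpha> \<kappa>"
    using ordinal_mem_or_subset[OF \<open>ordinal \<alpha>\<close> assms(1)] by blast
  then show ?thesis
    using \<open>B \<approx> elts \<alpha>\<close> eqpoll_imp_lepoll by blast
qed

lemma Vset_mono: "elts \<alpha> \<subseteq> elts \<beta> \<Longrightarrow> Vset \<alpha> \<subseteq> Vset \<beta>"
  by (meson Vset_iff subset_iff)

lemma Vset_eq: "Vset \<alpha> = (\<Union>\<beta>\<in>elts \<alpha>. {x. elts x \<subseteq> Vset \<beta>})"
  using Vset_iff by blast

lemma Vset_transitive:
  assumes "ordinal \<alpha>" "x \<in> Vset \<alpha>" "mem y x"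
  shows "y \<in> Vset \<alpha>"
proof -
  obtain \<beta> where "mem \<beta> \<alpha>" "elts x \<subseteq> Vset \<beta>"
    using assms(2) Vset_iff by blast
  moreover from this have "Vset \<beta> \<subseteq> Vset \<alpha>"
    using assms(1) by (intro Vset_mono) (auto simp: ordinal_trans)
  ultimately show ?thesis
    using assms(3) by blast
qed

lemma elts_subset_Vset: "ordinal \<alpha> \<Longrightarrow> elts \<alpha> \<subseteq> Vset (\<alpha> :: 'v::zfc_universe)"
proof (induction \<alpha> rule: mem_induct)
  case (step \<alpha>)
  then show ?case
    by (meson Vset_iff ordinal_mem subsetI)
qed

text \<open>If \<alpha> were in its own stage, some \<beta> in \<alpha> would have all of \<alpha>,
  and so \<beta> itself, inside \<open>Vset \<beta>\<close>, against the induction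
  hypothesis.\<close>

lemma not_in_Vset_self: "\<alpha> \<notin> Vset (\<alpha> :: 'v::zfc_universe)"
proof (induction \<alpha> rule: mem_induct)
  case (step \<alpha>)
  then show ?case
    by (meson Vset_iff subsetD)
qed

lemma Vset_is_set: "\<exists>v::'v::zfc_universe. elts v = Vset (\<alpha>::'v)"
proof (induction \<alpha> rule: mem_induct)
  case (step \<alpha>)
  have "\<forall>\<beta>\<in>elts \<alpha>. \<exists>p::'v. elts p = {x. elts x \<subseteq> Vset \<beta>}"
    using step power_ax by metis
  then obtain p :: "'v \<Rightarrow> 'v" where "\<forall>\<beta>\<in>elts \<alpha>. elts (p \<beta>) = {x. elts x \<subseteq> Vset \<beta>}"
    by metis
  then show ?case
    using Union_image_set[of p \<alpha>] by (simp add: Vset_eq[where \<alpha> = \<alpha>])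
qed

section \<open>Grothendieck universes\<close>

text \<open>The class provides no operation symbols, so each closure condition speaks of any set
  with the required elements; extensionality makes it unique. In \<open>image_closed\<close> the
  function is an arbitrary HOL function, as in second-order replacement.\<close>

locale grothendieck_universe =
  fixes N :: "'v::zfc_universe set"
  assumes transitive: "\<lbrakk>x \<in> N; mem y x\<rbrakk> \<Longrightarrow> y \<in> N"
    and power_closed: "\<lbrakk>x \<in> N; elts p = {z. elts z \<subseteq> elts x}\<rbrakk> \<Longrightarrow> p \<in> N"
    and union_closed: "\<lbrakk>x \<in> N; elts u = (\<Union>y\<in>elts x. elts y)\<rbrakk> \<Longrightarrow> u \<in> N"
    and image_closed: "\<lbrakk>x \<in> N; f ` elts x \<subseteq> N; elts b = f ` elts x\<rbrakk> \<Longrightarrow> b \<in> N"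
    and infinite: "\<exists>x\<in>N. infinite (elts x)"
begin

lemma subset_closed:
  assumes "x \<in> N" "elts y \<subseteq> elts x"
  shows "y \<in> N"
proof -
  obtain p where p: "elts p = {z. elts z \<subseteq> elts x}"
    using power_ax[of x] by blast
  then have "p \<in> N"
    using power_closed assms(1) by blast
  then show ?thesis
    using transitive[of p y] p assms(2) by blast
qed

text \<open>Limitation of size for \<open>N\<close>, the source of most of the closure properties
  below.\<close>

lemma lepoll_closed:
  assumes "x \<in> N" "elts s \<subseteq> N" "elts s \<lesssim> elts x"
  shows "s \<in> N"
proof -
  obtain g where g: "elts s \<subseteq> g ` elts x"
    using assms(3) unfolding lepoll_iff by blast
  \<comment> \<open>Elsewhere \<open>g\<close> may take values outside \<open>N\<close>; on the
    preimage of \<open>s\<close> its image is exactly \<open>s\<close>.\<close>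
  obtain y where y: "elts y = {a \<in> elts x. g a \<in> elts s}"
    using separation_ax[of x "\<lambda>a. g a \<in> elts s"] by blast
  have "y \<in> N"
    by (rule subset_closed[OF assms(1)]) (auto simp: y)
  moreover have "elts s = g ` elts y"
    unfolding y using g by blast
  ultimately show ?thesis
    using image_closed[of y g s] assms(2) by simp
qed

lemma finite_closed: "finite (elts s) \<Longrightarrow> elts s \<subseteq> N \<Longrightarrow> s \<in> N"
  using infinite lepoll_closed[of _ s] finite_lepoll_infinite[of _ "elts s"] by blast

lemma Union_image_closed:
  assumes "x \<in> N" "\<And>y. mem y x \<Longrightarrow> f y \<in> N" "elts s = (\<Union>y\<in>elts x. elts (f y))"
  shows "s \<in> N"
proof -
  obtain b where b: "elts b = f ` elts x"
    using replacement_ax[of f x] by blast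
  have "b \<in> N"
    by (rule image_closed[OF assms(1) _ b]) (use assms(2) in blast)
  then show ?thesis
    using union_closed[of b s] b assms(3) by simp
qed

lemma insert_closed:
  assumes "x \<in> N" "y \<in> N" "elts z = insert y (elts x)"
  shows "z \<in> N"
proof -
  obtain s where s: "elts s = {y}"
    using pairing_ax[of y y] by auto
  obtain t where t: "elts t = {x, s}"
    using pairing_ax[of x s] by auto
  have "s \<in> N" "t \<in> N"
    using finite_closed[of s] finite_closed[of t] s t assms by auto
  then show ?thesis
    using union_closed[of t z] t s assms(3) by auto
qed

text \<open>Hilbert choice picks a point \<open>c y\<close> in each member \<open>y\<close> of
  \<open>x\<close>. The set of these points is an image of \<open>x\<close> and so lies in
  \<open>N\<close>; disjointness prevents points picked elsewhere from falling into
  \<open>y\<close>.\<close>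

lemma choice_structure: "choice_structure N mem"
  unfolding choice_structure_def
proof (intro ballI impI, elim conjE)
  fix x assume x: "x \<in> N"
    and ne: "\<forall>y\<in>N. mem y x \<longrightarrow> (\<exists>z\<in>N. mem z y)"
    and disj: "\<forall>y\<in>N. \<forall>z\<in>N. mem y x \<and> mem z x \<and> (\<exists>u\<in>N. mem u y \<and> mem u z) \<longrightarrow> y = z"
  define c where "c y = (SOME z. mem z y)" for y :: 'v
  have c: "mem (c y) y" if "mem y x" for y
  proof -
    have "\<exists>z. mem z y"
      using ne transitive[OF x] that by blast
    then show ?thesis
      unfolding c_def by (rule someI_ex)
  qed
  obtain t where t: "elts t = c ` elts x"
    using replacement_ax[of c x] by blast
  have "t \<in> N"
    by (rule image_closed[OF x _ t]) (use c transitive x in blast)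
  moreover have "\<exists>z\<in>N. \<forall>u\<in>N. mem u y \<and> mem u t \<longleftrightarrow> u = z" if y: "y \<in> N" "mem y x" for y
  proof (intro bexI ballI)
    show "c y \<in> N"
      using c y transitive by blast
    fix u assume "u \<in> N"
    show "mem u y \<and> mem u t \<longleftrightarrow> u = c y"
    proof
      assume *: "mem u y \<and> mem u t"
      then obtain y' where y': "mem y' x" "u = c y'"
        using t by auto
      moreover have "y = y'"
        using disj y y' c * transitive[OF x] \<open>u \<in> N\<close> by blast
      ultimately show "u = c y" by simp
    next
      assume "u = c y"
      then show "mem u y \<and> mem u t"
        using c y t by simp
    qed
  qed
  ultimately show "\<exists>t\<in>N. \<forall>y\<in>N. mem y x \<longrightarrow> (\<exists>z\<in>N. \<forall>u\<in>N. mem u y \<and> mem u t \<longleftrightarrow> u = z)"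
    by blast
qed

text \<open>The finite ordinals form a countable subset of \<open>N\<close>, hence are no more
  numerous than an infinite member of \<open>N\<close>, and limitation of size applies.\<close>

lemma infinity_closed:
  "\<exists>w\<in>N. (\<exists>e\<in>elts w. elts e = {}) \<and> (\<forall>y\<in>elts w. \<exists>z\<in>elts w. elts z = insert y (elts y))"
proof -
  obtain e :: 'v where e: "elts e = {}"
    using subset_elts_imp_set[of "{}"] by blast
  obtain S :: "'v \<Rightarrow> 'v" where S: "\<And>y. elts (S y) = insert y (elts y)"
    using successor_exists by metis
  define a where "a n = (S ^^ n) e" for n
  have aN: "a n \<in> N" for n
  proof (induction n)
    case 0
    then show ?case
      using finite_closed[of e] e by (simp add: a_def)
  next
    case (Suc n)
    then show ?case
      using insert_closed[OF Suc Suc S] by (simp add: a_def)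
  qed
  obtain x where x: "x \<in> N" "infinite (elts x)"
    using infinite by blast
  then have *: "range a \<lesssim> elts x"
    by (meson image_lepoll infinite_le_lepoll lepoll_trans)
  then obtain w where w: "elts w = range a"
    using lepoll_elts_imp_set by blast
  have "w \<in> N"
    by (rule lepoll_closed[OF x(1)]) (use w aN * in auto)
  moreover have "\<exists>e\<in>elts w. elts e = {}"
    unfolding w using e by (intro bexI[of _ "a 0"] rangeI) (simp add: a_def)
  moreover have "\<exists>z\<in>elts w. elts z = insert y (elts y)" if y: "mem y w" for y
  proof -
    obtain n where "y = a n" using y w by auto
    then show ?thesis
      unfolding w using S by (intro bexI[of _ "a (Suc n)"] rangeI) (simp add: a_def)
  qed
  ultimately show ?thesis by blast
qed

lemma zf_structure: "zf_structure N mem"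
proof
  show "N \<noteq> {}"
    using infinite by blast
  show "\<exists>w\<in>N. (\<exists>e\<in>N. mem e w \<and> (\<forall>z\<in>N. \<not> mem z e)) \<and>
      (\<forall>y\<in>N. mem y w \<longrightarrow> (\<exists>z\<in>N. mem z w \<and> (\<forall>u\<in>N. mem u z \<longleftrightarrow> mem u y \<or> u = y)))"
  proof -
    obtain w where w: "w \<in> N" "\<exists>e\<in>elts w. elts e = {}"
      "\<forall>y\<in>elts w. \<exists>z\<in>elts w. elts z = insert y (elts y)"
      using infinity_closed by blast
    have "\<exists>e\<in>N. mem e w \<and> (\<forall>z\<in>N. \<not> mem z e)"
      using w transitive by (metis empty_iff)
    moreover have "\<exists>z\<in>N. mem z w \<and> (\<forall>u\<in>N. mem u z \<longleftrightarrow> mem u y \<or> u = y)" if "mem y w" for y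
      using w transitive that by (metis insert_iff)
    ultimately show ?thesis
      using w(1) by blast
  qed
next
  fix x y assume x: "x \<in> N"
  show "x = y" if "y \<in> N" "\<And>z. z \<in> N \<Longrightarrow> mem z x \<longleftrightarrow> mem z y"
  proof (rule extensionality_ax, rule set_eqI)
    show "mem z x \<longleftrightarrow> mem z y" for z
      using transitive[OF x, of z] transitive[OF that(1), of z] that(2)[of z] by blast
  qed
  show "\<exists>y\<in>N. mem y x \<and> \<not> (\<exists>z\<in>N. mem z y \<and> mem z x)" if "mem y x"
    using foundation_ax[of x] that transitive[OF x] by blast
  show "\<exists>z\<in>N. \<forall>u\<in>N. mem u z \<longleftrightarrow> u = x \<or> u = y" if "y \<in> N"
  proof -
    obtain z where z: "elts z = {x, y}"
      using pairing_ax[of x y] by blast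
    show ?thesis
      by (rule bexI[of _ z]) (use z finite_closed[of z] x that in auto)
  qed
  show "\<exists>u\<in>N. \<forall>z\<in>N. mem z u \<longleftrightarrow> (\<exists>y\<in>N. mem y x \<and> mem z y)"
  proof -
    obtain u where u: "elts u = (\<Union>y\<in>elts x. elts y)"
      using union_ax[of x] by blast
    show ?thesis
      by (rule bexI[of _ u]) (use u union_closed[OF x u] transitive[OF x] in auto)
  qed
  show "\<exists>p\<in>N. \<forall>z\<in>N. mem z p \<longleftrightarrow> (\<forall>y\<in>N. mem y z \<longrightarrow> mem y x)"
  proof -
    obtain p where p: "elts p = {z. elts z \<subseteq> elts x}"
      using power_ax[of x] by blast
    show ?thesis
      by (rule bexI[of _ p]) (use p power_closed[OF x p] transitive in auto)
  qed
  show "\<exists>b\<in>N. \<forall>z\<in>N. mem z b \<longleftrightarrow> mem z x \<and> P z" for P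
  proof -
    obtain b where b: "elts b = {z \<in> elts x. P z}"
      using separation_ax[of x P] by blast
    show ?thesis
      by (rule bexI[of _ b]) (use b subset_closed[OF x, of b] in auto)
  qed
  show "\<exists>b\<in>N. \<forall>z\<in>N. mem z b \<longleftrightarrow> (\<exists>y\<in>N. mem y x \<and> Q y z)"
    if Q: "\<And>x y z. \<lbrakk>x \<in> N; y \<in> N; z \<in> N; Q x y; Q x z\<rbrakk> \<Longrightarrow> y = z" for Q :: "'v \<Rightarrow> 'v \<Rightarrow> bool"
  proof -
    define A where "A = {z \<in> N. \<exists>y\<in>elts x. Q y z}"
    define F where "F y = (THE z. z \<in> N \<and> Q y z)" for y
    have F: "F y = z" if "y \<in> N" "z \<in> N" "Q y z" for y z
      unfolding F_def
    proof (rule the_equality)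
      show "u = z" if "u \<in> N \<and> Q y u" for u
        using Q[of y u z] that \<open>y \<in> N\<close> \<open>z \<in> N\<close> \<open>Q y z\<close> by simp
    qed (use that in simp)
    \<comment> \<open>\<open>Q\<close> may be partial, so \<open>F\<close> has junk values; only the
      inclusion is needed, since it bounds the size of \<open>A\<close>.\<close>
    have "A \<subseteq> F ` elts x"
      unfolding A_def using F transitive[OF x] by blast
    then have *: "A \<lesssim> elts x"
      by (rule subset_image_lepoll)
    then obtain b where b: "elts b = A"
      using lepoll_elts_imp_set by blast
    have "b \<in> N"
      by (rule lepoll_closed[OF x]) (use b * in \<open>auto simp: A_def\<close>)
    then show ?thesis
      by (rule bexI[rotated]) (use b transitive[OF x] in \<open>auto simp: A_def\<close>)
  qed
qed

lemma models_ZFC2: "models N mem ZFC2"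
  by (simp add: models_ZFC2_iff zf_structure choice_structure)

end

text \<open>By transitivity an extent is the true set of elements, so limitation of size in the
  model brings every true subset of a member into \<open>N\<close>. Hence power sets and unions
  computed in \<open>N\<close> are the true ones.\<close>

lemma transitive_zf_structure_imp_grothendieck_universe:
  fixes N :: "'v::zfc_universe set"
  assumes "zf_structure N mem" and trans: "\<And>x y. \<lbrakk>x \<in> N; mem y x\<rbrakk> \<Longrightarrow> y \<in> N"
  shows "grothendieck_universe N"
proof -
  interpret zf_structure N mem by fact
  have extent: "extent x = elts x" if "x \<in> N" for x
    using that trans by (auto simp: extent_def)
  have closed: "y \<in> N" if xy: "x \<in> N" "elts y \<subseteq> N" "elts y \<lesssim> elts x" for x y
  proof -
    obtain b where "b \<in> N" "elts b = elts y"
      using image_extent[of x "elts y"] xy extent by auto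
    then show ?thesis
      using extensionality_ax[of b y] by simp
  qed
  have sub: "y \<in> N" if "x \<in> N" "elts y \<subseteq> elts x" for x y
    using closed[of x y] that trans subset_imp_lepoll by blast
  show ?thesis
  proof
    show "p \<in> N" if x: "x \<in> N" and p: "elts p = {z. elts z \<subseteq> elts x}" for x p
    proof -
      obtain q where q: "q \<in> N" "\<forall>z\<in>N. mem z q \<longleftrightarrow> (\<forall>y\<in>N. mem y z \<longrightarrow> mem y x)"
        using power x by blast
      have "elts q = elts p"
      proof (rule set_eqI)
        fix z
        have "z \<in> N" if "mem z q \<or> mem z p"
          using that trans[OF q(1)] sub[OF x] unfolding p by blast
        moreover have "mem z q \<longleftrightarrow> mem z p" if "z \<in> N"
          unfolding p mem_Collect_eq subset_iff q(2)[rule_format, OF that]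
          using trans[OF that] by blast
        ultimately show "mem z q \<longleftrightarrow> mem z p"
          by blast
      qed
      then show ?thesis using q(1) extensionality_ax[of q p] by simp
    qed
    show "u \<in> N" if x: "x \<in> N" and u: "elts u = (\<Union>y\<in>elts x. elts y)" for x u
    proof -
      obtain v where v: "v \<in> N" "\<forall>z\<in>N. mem z v \<longleftrightarrow> (\<exists>y\<in>N. mem y x \<and> mem z y)"
        using union x by blast
      have "elts v = elts u"
      proof (rule set_eqI)
        fix z
        have "z \<in> N" if "mem z v \<or> mem z u"
          using that trans[OF v(1)] trans[OF trans[OF x]] unfolding u by blast
        moreover have "mem z v \<longleftrightarrow> mem z u" if "z \<in> N"
          unfolding u UN_iff v(2)[rule_format, OF that] using trans[OF x] by blast
        ultimately show "mem z v \<longleftrightarrow> mem z u"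
          by blast
      qed
      then show ?thesis using v(1) extensionality_ax[of v u] by simp
    qed
    show "b \<in> N" if "x \<in> N" "f ` elts x \<subseteq> N" "elts b = f ` elts x" for x b and f :: "'v \<Rightarrow> 'v"
      using closed[of x b] that image_lepoll[of f "elts x"] by simp
    show "\<exists>x\<in>N. infinite (elts x)"
      using infinite_extent extent by auto
  qed (fact trans)
qed

section \<open>From Grothendieck universes to inaccessible cardinals\<close>

context grothendieck_universe
begin

text \<open>By \<open>bounded\<close>, the ranks of the elements of a member of \<open>N\<close>
  stay below one \<beta> in \<mu>, so membership induction puts \<open>N\<close> into the hierarchy.
  Conversely each stage below \<mu> is a member of \<open>N\<close>, built from power sets and
  unions.\<close>

lemma eq_Vset_ordinals:
  assumes ord: "ordinal \<mu>" and \<mu>: "\<And>\<alpha>. mem \<alpha> \<mu> \<longleftrightarrow> \<alpha> \<in> N \<and> ordinal \<alpha>"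
    and bounded: "\<And>x f. \<lbrakk>x \<in> N; f ` elts x \<subseteq> elts \<mu>\<rbrakk> \<Longrightarrow> \<exists>\<beta>\<in>elts \<mu>. f ` elts x \<subseteq> elts \<beta>"
  shows "N = Vset \<mu>"
proof
  have "x \<in> N \<Longrightarrow> x \<in> Vset \<mu>" for x
  proof (induction x rule: mem_induct)
    case (step x)
    have "\<forall>y\<in>elts x. \<exists>\<beta>\<in>elts \<mu>. elts y \<subseteq> Vset \<beta>"
      using step transitive Vset_iff by blast
    then obtain g where g: "\<And>y. mem y x \<Longrightarrow> mem (g y) \<mu> \<and> elts y \<subseteq> Vset (g y)"
      by metis
    then obtain \<beta> where \<beta>: "mem \<beta> \<mu>" "g ` elts x \<subseteq> elts \<beta>"
      using bounded[of x g] step.prems by blast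
    have "elts x \<subseteq> Vset \<beta>"
      using g \<beta>(2) Vset_iff by blast
    then show ?case
      using \<beta>(1) Vset_iff by blast
  qed
  then show "N \<subseteq> Vset \<mu>" by blast
  have V: "mem \<alpha> \<mu> \<Longrightarrow> \<exists>v\<in>N. elts v = Vset \<alpha>" for \<alpha>
  proof (induction \<alpha> rule: mem_induct)
    case (step \<alpha>)
    have "\<forall>\<beta>\<in>elts \<alpha>. \<exists>p\<in>N. elts p = {x. elts x \<subseteq> Vset \<beta>}"
    proof
      fix \<beta> assume "mem \<beta> \<alpha>"
      then obtain v where v: "v \<in> N" "elts v = Vset \<beta>"
        using step ordinal_trans[OF ord] by blast
      obtain p where "elts p = {x. elts x \<subseteq> elts v}"
        using power_ax[of v] by blast
      then show "\<exists>p\<in>N. elts p = {x. elts x \<subseteq> Vset \<beta>}"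
        using power_closed[OF v(1)] v(2) by auto
    qed
    then obtain p where p: "\<And>\<beta>. mem \<beta> \<alpha> \<Longrightarrow> p \<beta> \<in> N \<and> elts (p \<beta>) = {x. elts x \<subseteq> Vset \<beta>}"
      by metis
    obtain v where v: "elts v = (\<Union>\<beta>\<in>elts \<alpha>. elts (p \<beta>))"
      using Union_image_set[of p \<alpha>] by blast
    have "v \<in> N"
      using Union_image_closed[of \<alpha> p v] v p \<mu> step.prems by blast
    moreover have "elts v = Vset \<alpha>"
      unfolding v Vset_eq[where \<alpha> = \<alpha>] using p by simp
    ultimately show ?case by blast
  qed
  show "Vset \<mu> \<subseteq> N"
  proof
    fix x assume "x \<in> Vset \<mu>"
    then obtain \<beta> where "mem \<beta> \<mu>" "elts x \<subseteq> Vset \<beta>"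
      using Vset_iff by blast
    then show "x \<in> N"
      using V[of \<beta>] subset_closed by auto
  qed
qed

text \<open>Since \<open>N\<close> is a set, its ordinals form a set \<mu>, and \<mu> is not in
  \<open>N\<close>, for otherwise it would be its own member. Limitation of size then makes every
  member of \<open>N\<close> strictly smaller than \<mu>. Applied to ordinals, to power sets and to
  an infinite member, this shows that \<mu> is a cardinal, a strong limit and uncountable.\<close>

lemma eq_Vset_inaccessible:
  assumes "elts n = N"
  shows "\<exists>\<mu>. inaccessible \<mu> \<and> N = Vset \<mu>"
proof -
  obtain \<mu> where \<mu>: "elts \<mu> = {\<alpha> \<in> N. ordinal \<alpha>}"
    using separation_ax[of n ordinal] assms by auto
  have ord: "ordinal \<mu>"
    by (rule ordinalI) (use \<mu> transitive ordinal_mem in auto)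
  have "\<mu> \<notin> N"
    using ord \<mu> not_mem_self[of \<mu>] by auto
  then have small: "\<not> elts \<mu> \<lesssim> elts x" if "x \<in> N" for x
    using lepoll_closed[OF that, of \<mu>] \<mu> by auto
  have less: "elts x \<prec> elts \<mu>" if "x \<in> N" for x
    using small[OF that] lepoll_linear[of "elts x" "elts \<mu>"] eqpoll_imp_lepoll[OF eqpoll_sym]
    unfolding lesspoll_def by blast
  obtain w where w: "w \<in> N" "infinite (elts w)"
    using infinite by blast
  have bounded: "\<exists>\<beta>\<in>elts \<mu>. f ` elts x \<subseteq> elts \<beta>" if x: "x \<in> N" "f ` elts x \<subseteq> elts \<mu>" for x f
  proof -
    obtain S :: "'v \<Rightarrow> 'v" where S: "\<And>y. elts (S y) = insert y (elts y)"
      using successor_exists by metis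
    \<comment> \<open>The supremum of the successors: without \<open>S\<close> the values would be
      subsets of \<beta> but not necessarily members.\<close>
    obtain \<beta> where \<beta>: "elts \<beta> = (\<Union>y\<in>elts x. elts (S (f y)))"
      using Union_image_set[of "\<lambda>y. S (f y)" x] by blast
    have f: "f y \<in> N \<and> ordinal (f y)" if "mem y x" for y
      using x that \<mu> by auto
    have "\<beta> \<in> N"
      by (rule Union_image_closed[OF x(1) _ \<beta>]) (use f insert_closed[OF _ _ S] in blast)
    moreover have "ordinal \<beta>"
    proof (rule ordinalI)
      show "ordinal \<gamma>" if "mem \<gamma> \<beta>" for \<gamma>
        using that f ordinal_mem unfolding \<beta> S by blast
      show "mem \<delta> \<beta>" if "mem \<gamma> \<beta>" "mem \<delta> \<gamma>" for \<gamma> \<delta>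
        using that f ordinal_trans unfolding \<beta> S by blast
    qed
    moreover have "f ` elts x \<subseteq> elts \<beta>"
      unfolding \<beta> S by blast
    ultimately show ?thesis
      using \<mu> by blast
  qed
  have card: "cardinal \<mu>"
    using ord less \<mu> by (auto simp: cardinal_def)
  have "infinite (elts \<mu>)"
    using less[OF w(1)] w(2) by (meson finite_lepoll_infinite infinite_le_lepoll lepoll_trans lesspoll_def)
  then have "regular \<mu>"
    using card bounded \<mu> unfolding regular_def by blast
  moreover have "strong_limit \<mu>"
    unfolding strong_limit_def
  proof (intro conjI ballI card)
    fix \<alpha> assume \<alpha>: "mem \<alpha> \<mu>"
    obtain p where p: "elts p = {z. elts z \<subseteq> elts \<alpha>}"
      using power_ax[of \<alpha>] by blast
    have "p \<in> N"
      using power_closed[OF _ p] \<alpha> \<mu> by blast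
    have "Pow (elts \<alpha>) \<subseteq> elts ` elts p"
    proof
      fix A assume "A \<in> Pow (elts \<alpha>)"
      moreover from this obtain z where "elts z = A"
        using subset_elts_imp_set by blast
      ultimately show "A \<in> elts ` elts p"
        unfolding p by blast
    qed
    then have "Pow (elts \<alpha>) \<lesssim> elts p"
      by (rule subset_image_lepoll)
    then show "Pow (elts \<alpha>) \<prec> elts \<mu>"
      using less[OF \<open>p \<in> N\<close>] by (rule lesspoll_trans1)
  qed
  moreover have "uncountable (elts \<mu>)"
  proof
    assume "countable (elts \<mu>)"
    then have "elts \<mu> \<lesssim> (UNIV :: nat set)"
      unfolding countable_def lepoll_def by blast
    also have "(UNIV :: nat set) \<lesssim> elts w"
      using w(2) infinite_le_lepoll by blast
    finally show False
      using small w(1) by blast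
  qed
  ultimately have "inaccessible \<mu>"
    by (simp add: inaccessible_def)
  moreover have "N = Vset \<mu>"
    using eq_Vset_ordinals[OF ord _ bounded] \<mu> by blast
  ultimately show ?thesis by blast
qed

end

section \<open>From inaccessible cardinals to Grothendieck universes\<close>

lemma inaccessible_ordinal: "inaccessible \<kappa> \<Longrightarrow> ordinal \<kappa>"
  by (simp add: inaccessible_def regular_def cardinal_def)

text \<open>Extends regularity from functions on a member of \<kappa> to functions on any collection
  of at most that size, by composing with a covering map.\<close>

lemma inaccessible_bounded:
  fixes \<kappa> :: "'v::zfc_universe"
  assumes \<kappa>: "inaccessible \<kappa>" and "mem \<alpha> \<kappa>" "B \<lesssim> elts \<alpha>" "f ` B \<subseteq> elts \<kappa>"
  shows "\<exists>\<beta>\<in>elts \<kappa>. f ` B \<subseteq> elts \<beta>"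
proof -
  obtain g where g: "B \<subseteq> g ` elts \<alpha>"
    using assms(3) unfolding lepoll_iff by blast
  \<comment> \<open>The default \<alpha> is just some member of \<kappa>; it keeps \<open>h\<close>
    inside \<kappa> where \<open>g\<close> leaves \<open>B\<close>.\<close>
  define h where "h a = (if g a \<in> B then f (g a) else \<alpha>)" for a
  have "h ` elts \<alpha> \<subseteq> elts \<kappa>"
    using assms(2,4) by (auto simp: h_def)
  moreover have "\<forall>f. f ` elts \<alpha> \<subseteq> elts \<kappa> \<longrightarrow> (\<exists>\<beta>\<in>elts \<kappa>. f ` elts \<alpha> \<subseteq> elts \<beta>)"
    using \<kappa> assms(2) by (simp add: inaccessible_def regular_def)
  ultimately obtain \<beta> where "mem \<beta> \<kappa>" "h ` elts \<alpha> \<subseteq> elts \<beta>"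
    by (meson spec[of _ h])
  moreover have "f ` B \<subseteq> h ` elts \<alpha>"
  proof
    fix z assume "z \<in> f ` B"
    then obtain a where "mem a \<alpha>" "g a \<in> B" "z = f (g a)"
      using g by blast
    then show "z \<in> h ` elts \<alpha>"
      by (intro image_eqI[of _ _ a]) (simp_all add: h_def)
  qed
  ultimately show ?thesis by blast
qed

lemma inaccessible_infinite_mem:
  fixes \<kappa> :: "'v::zfc_universe"
  assumes "inaccessible \<kappa>"
  shows "\<exists>\<alpha>\<in>elts \<kappa>. infinite (elts \<alpha>)"
proof -
  have "infinite (elts \<kappa>)" "uncountable (elts \<kappa>)"
    using assms by (auto simp: inaccessible_def regular_def)
  then have "(UNIV :: nat set) \<prec> elts \<kappa>"
    unfolding lesspoll_def
    using infinite_le_lepoll[of "elts \<kappa>"] countable_eqpoll[of "UNIV :: nat set" "elts \<kappa>"]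
      eqpoll_sym[of "UNIV :: nat set" "elts \<kappa>"] by auto
  then obtain \<alpha> where "mem \<alpha> \<kappa>" "(UNIV :: nat set) \<lesssim> elts \<alpha>"
    using lesspoll_ordinal_imp_lepoll_mem inaccessible_ordinal[OF assms] by blast
  then show ?thesis
    using infinite_le_lepoll by blast
qed

text \<open>Regularity yields one infinite \<epsilon> in \<kappa> that dominates all earlier stages.
  \<open>Vset \<beta>\<close> is then a union of at most |\<epsilon>| many sets of size at most
  2^|\<epsilon>|, and the strong limit property puts this below \<kappa>.\<close>

lemma inaccessible_Vset_lepoll:
  fixes \<kappa> :: "'v::zfc_universe"
  assumes \<kappa>: "inaccessible \<kappa>"
  shows "mem \<beta> \<kappa> \<Longrightarrow> \<exists>\<alpha>\<in>elts \<kappa>. Vset \<beta> \<lesssim> elts \<alpha>"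
proof (induction \<beta> rule: mem_induct)
  case (step \<beta>)
  have ord: "ordinal \<kappa>"
    using \<kappa> by (rule inaccessible_ordinal)
  obtain \<omega> where \<omega>: "mem \<omega> \<kappa>" "infinite (elts \<omega>)"
    using inaccessible_infinite_mem[OF \<kappa>] by blast
  have "\<forall>\<gamma>\<in>elts \<beta>. \<exists>\<alpha>\<in>elts \<kappa>. Vset \<gamma> \<lesssim> elts \<alpha>"
    using step ordinal_trans[OF ord] by blast
  then obtain g where g: "\<And>\<gamma>. mem \<gamma> \<beta> \<Longrightarrow> mem (g \<gamma>) \<kappa> \<and> Vset \<gamma> \<lesssim> elts (g \<gamma>)"
    by metis
  then obtain \<delta> where \<delta>: "mem \<delta> \<kappa>" "g ` elts \<beta> \<subseteq> elts \<delta>"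
    using inaccessible_bounded[OF \<kappa> step.prems lepoll_refl, of g] by blast
  have dir: "\<exists>\<epsilon>\<in>elts \<kappa>. elts \<alpha> \<union> elts \<alpha>' \<subseteq> elts \<epsilon>" if "mem \<alpha> \<kappa>" "mem \<alpha>' \<kappa>" for \<alpha> \<alpha>'
  proof -
    have "ordinal \<alpha>" "ordinal \<alpha>'"
      using that ordinal_mem[OF ord] by blast+
    then have "elts \<alpha> \<subseteq> elts \<alpha>' \<or> elts \<alpha>' \<subseteq> elts \<alpha>"
      using ordinal_mem_or_subset[of \<alpha> \<alpha>'] ordinal_trans[of \<alpha>' \<alpha>] by blast
    then show ?thesis
      using that by (auto simp: Un_absorb1 Un_absorb2)
  qed
  obtain \<epsilon>' where \<epsilon>': "mem \<epsilon>' \<kappa>" "elts \<omega> \<union> elts \<beta> \<subseteq> elts \<epsilon>'"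
    using dir[OF \<omega>(1) step.prems] by blast
  \<comment> \<open>\<epsilon> has three duties: it includes \<omega> and so is infinite, it
    includes the index set \<beta>, and through \<delta> it includes every
    \<open>g \<gamma>\<close>.\<close>
  obtain \<epsilon> where \<epsilon>: "mem \<epsilon> \<kappa>" "elts \<epsilon>' \<union> elts \<delta> \<subseteq> elts \<epsilon>"
    using dir[OF \<epsilon>'(1) \<delta>(1)] by blast
  have "infinite (elts \<epsilon>)"
    using \<omega>(2) \<epsilon>'(2) \<epsilon>(2) finite_subset[of "elts \<omega>" "elts \<epsilon>"] by blast
  have "Vset \<beta> \<lesssim> Pow (elts \<epsilon>)"
    unfolding Vset_eq[where \<alpha> = \<beta>]
  proof (rule lepoll_UNION)
    show "infinite (Pow (elts \<epsilon>))"
      using \<open>infinite (elts \<epsilon>)\<close> by simp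
    have "elts \<beta> \<lesssim> elts \<epsilon>"
      using \<epsilon>'(2) \<epsilon>(2) by (intro subset_imp_lepoll) blast
    then show "elts \<beta> \<lesssim> Pow (elts \<epsilon>)"
      using lepoll_Pow_self by (rule lepoll_trans)
    fix \<gamma> assume \<gamma>: "mem \<gamma> \<beta>"
    then have "mem (g \<gamma>) \<epsilon>"
      using \<delta>(2) \<epsilon>(2) by blast
    then have "elts (g \<gamma>) \<subseteq> elts \<epsilon>"
      using ordinal_trans[OF ordinal_mem[OF ord \<epsilon>(1)]] by blast
    then have "Vset \<gamma> \<lesssim> elts \<epsilon>"
      using g[OF \<gamma>] by (meson lepoll_trans subset_imp_lepoll)
    then have "Pow (Vset \<gamma>) \<lesssim> Pow (elts \<epsilon>)"
      by (rule lepoll_Pow_mono)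
    moreover have "{x. elts x \<subseteq> Vset \<gamma>} \<lesssim> Pow (Vset \<gamma>)"
      unfolding lepoll_def by (intro exI[of _ elts]) (auto intro!: inj_onI extensionality_ax)
    ultimately show "{x. elts x \<subseteq> Vset \<gamma>} \<lesssim> Pow (elts \<epsilon>)"
      using lepoll_trans by blast
  qed
  moreover have "Pow (elts \<epsilon>) \<prec> elts \<kappa>"
    using \<kappa> \<epsilon>(1) by (simp add: inaccessible_def strong_limit_def)
  ultimately have "Vset \<beta> \<prec> elts \<kappa>"
    by (rule lesspoll_trans1)
  then show ?case
    by (rule lesspoll_ordinal_imp_lepoll_mem[OF ord])
qed

lemma inaccessible_imp_grothendieck_universe:
  fixes \<kappa> :: "'v::zfc_universe"
  assumes \<kappa>: "inaccessible \<kappa>"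
  shows "grothendieck_universe (Vset \<kappa>)"
proof
  have ord: "ordinal \<kappa>"
    using \<kappa> by (rule inaccessible_ordinal)
  obtain \<omega> where \<omega>: "mem \<omega> \<kappa>" "infinite (elts \<omega>)"
    using inaccessible_infinite_mem[OF \<kappa>] by blast
  show "y \<in> Vset \<kappa>" if "x \<in> Vset \<kappa>" "mem y x" for x y
    using Vset_transitive[OF ord] that by blast
  show "u \<in> Vset \<kappa>" if x: "x \<in> Vset \<kappa>" and u: "elts u = (\<Union>y\<in>elts x. elts y)" for x u
  proof -
    obtain \<beta> where \<beta>: "mem \<beta> \<kappa>" "elts x \<subseteq> Vset \<beta>"
      using x Vset_iff by blast
    have "elts u \<subseteq> Vset \<beta>"
      unfolding u using \<beta>(2) Vset_transitive[OF ordinal_mem[OF ord \<beta>(1)]] by blast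
    then show ?thesis
      using \<beta>(1) Vset_iff by blast
  qed
  show "p \<in> Vset \<kappa>" if x: "x \<in> Vset \<kappa>" and p: "elts p = {z. elts z \<subseteq> elts x}" for x p
  proof -
    obtain \<beta> where \<beta>: "mem \<beta> \<kappa>" "elts x \<subseteq> Vset \<beta>"
      using x Vset_iff by blast
    \<comment> \<open>That \<kappa> is a limit is drawn from regularity: a bound for a constant
      function on a nonempty set has \<beta> as a member. The subsets of \<open>x\<close> then lie
      in \<open>Vset \<gamma>\<close>.\<close>
    obtain \<gamma> where \<gamma>: "mem \<gamma> \<kappa>" "(\<lambda>_. \<beta>) ` elts \<omega> \<subseteq> elts \<gamma>"
      using inaccessible_bounded[OF \<kappa> \<omega>(1) lepoll_refl, of "\<lambda>_. \<beta>"] \<beta>(1) by blast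
    moreover have "elts \<omega> \<noteq> {}"
      using \<omega>(2) by auto
    ultimately have "mem \<beta> \<gamma>"
      by blast
    then have "elts p \<subseteq> Vset \<gamma>"
      unfolding p using \<beta>(2) Vset_iff by blast
    then show ?thesis
      using \<gamma>(1) Vset_iff by blast
  qed
  show "b \<in> Vset \<kappa>"
    if x: "x \<in> Vset \<kappa>" and f: "f ` elts x \<subseteq> Vset \<kappa>" and b: "elts b = f ` elts x"
    for x b and f :: "'v \<Rightarrow> 'v"
  proof -
    obtain \<beta> where \<beta>: "mem \<beta> \<kappa>" "elts x \<subseteq> Vset \<beta>"
      using x Vset_iff by blast
    obtain \<alpha> where \<alpha>: "mem \<alpha> \<kappa>" "Vset \<beta> \<lesssim> elts \<alpha>"
      using inaccessible_Vset_lepoll[OF \<kappa> \<beta>(1)] by blast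
    \<comment> \<open>The size of \<open>x\<close> is bounded through the stage that includes it, so
      regularity can bound the ranks of the values of \<open>f\<close>.\<close>
    have "elts x \<lesssim> elts \<alpha>"
      using subset_imp_lepoll[OF \<beta>(2)] \<alpha>(2) by (rule lepoll_trans)
    moreover have "\<forall>y\<in>elts x. \<exists>\<gamma>\<in>elts \<kappa>. elts (f y) \<subseteq> Vset \<gamma>"
      using f Vset_iff by blast
    then obtain g where g: "\<And>y. mem y x \<Longrightarrow> mem (g y) \<kappa> \<and> elts (f y) \<subseteq> Vset (g y)"
      by metis
    ultimately obtain \<gamma> where \<gamma>: "mem \<gamma> \<kappa>" "g ` elts x \<subseteq> elts \<gamma>"
      using inaccessible_bounded[OF \<kappa> \<alpha>(1), of "elts x" g] by blast
    have "elts b \<subseteq> Vset \<gamma>"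
      unfolding b using g \<gamma>(2) Vset_iff by blast
    then show ?thesis
      using \<gamma>(1) Vset_iff by blast
  qed
  show "\<exists>x\<in>Vset \<kappa>. infinite (elts x)"
    using elts_subset_Vset[OF ord] \<omega> by blast
qed

section \<open>Invariance under isomorphism and Zermelo's quasi-categoricity\<close>

context
  fixes f :: "'m \<Rightarrow> 'n" and M N E F
  assumes bij: "bij_betw f M N"
    and iso: "\<And>x y. \<lbrakk>x \<in> M; y \<in> M\<rbrakk> \<Longrightarrow> E x y \<longleftrightarrow> F (f x) (f y)"
begin

lemma relations_image: "relations N n = (`) (map f) ` relations M n"
proof -
  have "{ys. length ys = n \<and> set ys \<subseteq> N} = map f ` {xs. length xs = n \<and> set xs \<subseteq> M}"
  proof (intro equalityI subsetI)
    fix ys assume ys: "ys \<in> {ys. length ys = n \<and> set ys \<subseteq> N}"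
    have "map f (map (inv_into M f) ys) = ys"
      using ys bij by (auto simp: bij_betw_def map_idI f_inv_into_f subset_iff)
    moreover have "set (map (inv_into M f) ys) \<subseteq> M"
      using ys bij by (auto simp: bij_betw_def inv_into_into)
    ultimately show "ys \<in> map f ` {xs. length xs = n \<and> set xs \<subseteq> M}"
      using ys by (intro image_eqI[of _ _ "map (inv_into M f) ys"]) simp_all
  qed (use bij in \<open>auto simp: bij_betw_def subset_iff\<close>)
  then show ?thesis
    by (simp add: relations_def image_Pow_surj)
qed

text \<open>Relation variables are transported by taking images. The atom \<open>Rel\<close> needs
  \<open>map f\<close> to be injective on lists over \<open>M\<close>, hence the condition on the
  assignments; \<open>Forall2\<close> needs every relation on \<open>N\<close> to be such an
  image.\<close>

lemma sat_iso:
  "\<lbrakk>\<And>x. s x \<in> M; \<And>n X. r (n, X) \<in> relations M n\<rbrakk> \<Longrightarrow>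
    sat N F (\<lambda>x. f (s x)) (\<lambda>p. map f ` r p) \<phi> \<longleftrightarrow> sat M E s r \<phi>"
proof (induction \<phi> arbitrary: s r)
  case (Mem x y)
  then show ?case by (simp add: iso)
next
  case (Eq x y)
  then show ?case
    using bij by (auto simp: bij_betw_def inj_on_def)
next
  case (Rel X xs)
  have "inj_on (map f) (lists M)"
    using bij by (simp add: bij_betw_def inj_on_map_lists)
  moreover have "map s xs \<in> lists M"
    using Rel(1) by auto
  moreover have "r (length xs, X) \<subseteq> lists M"
    using Rel(2)[of "length xs" X] by (auto simp: relations_def in_lists_conv_set)
  ultimately have "map f (map s xs) \<in> map f ` r (length xs, X) \<longleftrightarrow> map s xs \<in> r (length xs, X)"
    by (rule inj_on_image_mem_iff)
  then show ?case
    by (simp add: comp_def)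
next
  case (Neg \<phi>)
  then show ?case by simp
next
  case (And \<phi> \<psi>)
  then show ?case by simp
next
  case (Forall x \<phi>)
  have "sat N F ((\<lambda>x. f (s x))(x := f a)) (\<lambda>p. map f ` r p) \<phi> \<longleftrightarrow> sat M E (s(x := a)) r \<phi>"
    if "a \<in> M" for a
  proof -
    have "(\<lambda>x. f (s x))(x := f a) = (\<lambda>y. f ((s(x := a)) y))"
      by auto
    moreover have "sat N F (\<lambda>y. f ((s(x := a)) y)) (\<lambda>p. map f ` r p) \<phi> \<longleftrightarrow> sat M E (s(x := a)) r \<phi>"
      by (rule Forall.IH) (use Forall.prems that in auto)
    ultimately show ?thesis
      by (simp only:)
  qed
  moreover have "N = f ` M"
    using bij by (simp add: bij_betw_def)
  ultimately show ?case
    by simp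
next
  case (Forall2 n X \<phi>)
  have "sat N F (\<lambda>x. f (s x)) ((\<lambda>p. map f ` r p)((n, X) := map f ` A)) \<phi> \<longleftrightarrow>
      sat M E s (r((n, X) := A)) \<phi>" if "A \<in> relations M n" for A
  proof -
    have "(\<lambda>p. map f ` r p)((n, X) := map f ` A) = (\<lambda>p. map f ` (r((n, X) := A)) p)"
      by (rule ext) simp
    moreover have "sat N F (\<lambda>x. f (s x)) (\<lambda>p. map f ` (r((n, X) := A)) p) \<phi> \<longleftrightarrow>
        sat M E s (r((n, X) := A)) \<phi>"
      by (rule Forall2.IH) (use Forall2.prems that in auto)
    ultimately show ?thesis
      by (simp only:)
  qed
  then show ?case
    by (simp add: relations_image)
qed

lemma models_iso:
  assumes "models M E T"
  shows "models N F T"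
  unfolding models_def
proof (intro conjI ballI allI impI)
  show "N \<noteq> {}"
    using assms bij by (auto simp: models_def bij_betw_def)
next
  fix \<phi> and s' :: "nat \<Rightarrow> 'n" and r' :: "nat \<times> nat \<Rightarrow> 'n list set"
  assume "\<phi> \<in> T" and s': "\<forall>x. s' x \<in> N" and r': "\<forall>n X. r' (n, X) \<in> relations N n"
  \<comment> \<open>By surjectivity every assignment in \<open>N\<close> comes from one in
    \<open>M\<close>, to which \<open>sat_iso\<close> applies.\<close>
  have "\<forall>x. \<exists>a\<in>M. s' x = f a"
    using s' bij by (auto simp: bij_betw_def)
  then obtain s where s: "\<And>x. s x \<in> M \<and> s' x = f (s x)"
    by metis
  have "\<forall>p. \<exists>A\<in>relations M (fst p). r' p = map f ` A"
    using r' relations_image by (metis imageE prod.collapse)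
  then obtain r where r: "\<And>p. r p \<in> relations M (fst p) \<and> r' p = map f ` r p"
    by metis
  have "r (n, X) \<in> relations M n" for n X
    using r[of "(n, X)"] by simp
  moreover from this have "sat M E s r \<phi>"
    using assms \<open>\<phi> \<in> T\<close> s by (simp add: models_def)
  ultimately have "sat N F (\<lambda>x. f (s x)) (\<lambda>p. map f ` r p) \<phi>"
    using sat_iso[of s r \<phi>] s by blast
  moreover have "s' = (\<lambda>x. f (s x))" "r' = (\<lambda>p. map f ` r p)"
    using s r by auto
  ultimately show "sat N F s' r' \<phi>" by simp
qed

end

lemma isomorphic_models:
  assumes "isomorphic M E N F" "models M E T"
  shows "models N F T"
  using assms models_iso unfolding isomorphic_def by metis

theorem zermelo_quasi_categoricity:
  fixes m :: "'v::zfc_universe"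
  assumes "models (elts m) E ZFC2"
  shows "\<exists>\<mu>::'v. inaccessible \<mu> \<and> isomorphic (elts m) E (Vset \<mu>) mem"
proof -
  interpret zf_structure "elts m" E
    using assms models_ZFC2_iff by blast
  define R where "R = {(y, x). y \<in> elts m \<and> x \<in> elts m \<and> E y x}"
  have wf: "wf R"
    unfolding R_def by (rule wf_membership)
  have set_like: "\<exists>s. elts s = {y. (y, x) \<in> R}" for x
    by (rule subset_elts_imp_set[of _ m]) (auto simp: R_def)
  obtain c :: "'v \<Rightarrow> 'v" where c: "\<And>x. elts (c x) = c ` {y. (y, x) \<in> R}"
    using mostowski_collapse[OF wf set_like] by blast
  have inj: "inj_on c (elts m)"
  proof (rule collapse_inj_on[OF wf c])
    show "x = y" if "mem x m" "mem y m" "\<And>z. (z, x) \<in> R \<longleftrightarrow> (z, y) \<in> R" for x y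
    proof (rule extensional)
      show "E z x \<longleftrightarrow> E z y" if "mem z m" for z
        using \<open>(z, x) \<in> R \<longleftrightarrow> (z, y) \<in> R\<close> \<open>mem x m\<close> \<open>mem y m\<close> that by (simp add: R_def)
    qed fact+
  qed (auto simp: R_def)
  \<comment> \<open>The carrier is a set, hence so is its collapse;
    \<open>eq_Vset_inaccessible\<close> requires this.\<close>
  obtain n where n: "elts n = c ` elts m"
    using replacement_ax[of c m] by blast
  have "mem (c x) (c y) \<longleftrightarrow> E x y" if "mem x m" "mem y m" for x y
    unfolding c using that inj_on_image_mem_iff[OF inj that(1), of "{z. (z, y) \<in> R}"]
    by (auto simp: R_def)
  then have iso: "isomorphic (elts m) E (elts n) mem"
    unfolding isomorphic_def n using inj by (intro exI[of _ c]) (simp add: bij_betw_def)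
  then have "models (elts n) mem ZFC2"
    using assms by (rule isomorphic_models)
  then interpret N: grothendieck_universe "elts n"
  proof (intro transitive_zf_structure_imp_grothendieck_universe)
    show "mem y n" if "mem x n" "mem y x" for x y
      using that by (auto simp: n c R_def)
  qed (simp add: models_ZFC2_iff)
  show ?thesis
    using N.eq_Vset_inaccessible[OF refl] iso by metis
qed

section \<open>Categoricity relative to a universe\<close>

lemma models_Un: "models M E (S \<union> T) \<longleftrightarrow> models M E S \<and> models M E T"
  unfolding models_def by blast

text \<open>Serves both the whole universe and \<open>Vset \<theta>\<close>. In
  \<open>unique\<close>, the carrier \<open>m\<close> and its size are all that is kept of the
  model; for \<open>Vset \<theta>\<close> this is what places \<mu> below \<theta>.\<close>

lemma categorically_characterizesI:
  fixes \<kappa> :: "'v::zfc_universe"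
  assumes "inaccessible \<kappa>" "models (Vset \<kappa>) mem \<Sigma>"
    and v: "\<exists>v\<in>U. elts v = Vset \<kappa>"
    and unique: "\<And>\<mu> m. \<lbrakk>inaccessible \<mu>; models (Vset \<mu>) mem \<Sigma>; m \<in> U; elts m \<approx> Vset \<mu>\<rbrakk> \<Longrightarrow> \<mu> = \<kappa>"
  shows "categorically_characterizes_in U \<Sigma> \<kappa>"
proof -
  have "models (Vset \<kappa>) mem (ZFC2 \<union> \<Sigma>)"
    using assms(1,2) inaccessible_imp_grothendieck_universe grothendieck_universe.models_ZFC2
    unfolding models_Un by blast
  moreover have "isomorphic (elts m) E (Vset \<kappa>) mem"
    if m: "m \<in> U" "models (elts m) E (ZFC2 \<union> \<Sigma>)" for m E
  proof -
    obtain \<mu> :: 'v where \<mu>: "inaccessible \<mu>" and iso: "isomorphic (elts m) E (Vset \<mu>) mem"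
      using zermelo_quasi_categoricity[of m E] m(2) models_Un by blast
    have "models (Vset \<mu>) mem \<Sigma>"
      using isomorphic_models[OF iso, of \<Sigma>] m(2) models_Un by blast
    moreover have "elts m \<approx> Vset \<mu>"
      using iso unfolding isomorphic_def eqpoll_def by blast
    ultimately have "\<mu> = \<kappa>"
      using unique \<mu> m(1) by blast
    with iso show ?thesis by simp
  qed
  ultimately show ?thesis
    using v unfolding categorically_characterizes_in_def by blast
qed

text \<open>Otherwise \<theta> would be a subset of \<mu>, hence of \<open>Vset \<mu>\<close>, and
  so no larger than \<open>m\<close>. Limitation of size in \<open>Vset \<theta>\<close> would then
  make \<theta> a member of its own stage.\<close>

lemma inaccessible_mem_if_eqpoll:
  fixes \<mu> \<theta> :: "'v::zfc_universe"
  assumes \<mu>: "inaccessible \<mu>" and \<theta>: "inaccessible \<theta>" and m: "m \<in> Vset \<theta>" "elts m \<approx> Vset \<mu>"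
  shows "mem \<mu> \<theta>"
proof (rule ccontr)
  assume "\<not> mem \<mu> \<theta>"
  interpret grothendieck_universe "Vset \<theta>"
    using \<theta> by (rule inaccessible_imp_grothendieck_universe)
  have ord: "ordinal \<mu>" "ordinal \<theta>"
    using \<mu> \<theta> inaccessible_ordinal by blast+
  then have "elts \<theta> \<subseteq> elts \<mu>"
    using ordinal_mem_or_subset \<open>\<not> mem \<mu> \<theta>\<close> by blast
  then have "elts \<theta> \<subseteq> Vset \<mu>"
    using elts_subset_Vset[OF ord(1)] by blast
  then have "elts \<theta> \<lesssim> elts m"
    using m(2) by (meson eqpoll_sym lepoll_trans2 subset_imp_lepoll)
  then have "\<theta> \<in> Vset \<theta>"
    using lepoll_closed[OF m(1)] elts_subset_Vset[OF ord(2)] by blast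
  then show False
    using not_in_Vset_self by blast
qed

theorem theorem6:
  fixes \<Sigma> :: "fm set" and \<kappa> :: "'v::zfc_universe"
  assumes "\<forall>\<sigma>\<in>\<Sigma>. sentence \<sigma>"
    and "inaccessible \<kappa>"
    and "models (Vset \<kappa>) mem \<Sigma>"
  shows "(categorically_characterizes_in UNIV \<Sigma> \<kappa> \<and>
          (\<forall>\<mu>::'v. inaccessible \<mu> \<and> models (Vset \<mu>) mem \<Sigma> \<longrightarrow> \<mu> = \<kappa>))
       \<or> (\<exists>\<kappa>' \<theta>::'v. inaccessible \<kappa>' \<and> inaccessible \<theta> \<and> \<kappa>' \<in> elts \<theta> \<and>
            models (Vset \<kappa>') mem \<Sigma> \<and>
            (\<forall>\<mu>\<in>elts \<theta>. inaccessible \<mu> \<and> models (Vset \<mu>) mem \<Sigma> \<longrightarrow> \<mu> = \<kappa>') \<and>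
            models (Vset \<theta>) mem ZFC2 \<and>
            categorically_characterizes_in (Vset \<theta>) \<Sigma> \<kappa>')"
proof (cases "\<forall>\<mu>::'v. inaccessible \<mu> \<and> models (Vset \<mu>) mem \<Sigma> \<longrightarrow> \<mu> = \<kappa>")
  case True
  have "categorically_characterizes_in UNIV \<Sigma> \<kappa>"
    by (rule categorically_characterizesI[OF assms(2,3)]) (use True Vset_is_set in auto)
  with True show ?thesis by blast
next
  case False
  define S where "S = {\<mu>::'v. inaccessible \<mu> \<and> models (Vset \<mu>) mem \<Sigma>}"
  have ord: "ordinal \<mu>" if "\<mu> \<in> S" for \<mu>
    using that inaccessible_ordinal by (auto simp: S_def)
  have "\<kappa> \<in> S"
    using assms by (simp add: S_def)
  then obtain \<kappa>' where \<kappa>': "\<kappa>' \<in> S" "\<And>\<mu>. mem \<mu> \<kappa>' \<Longrightarrow> \<mu> \<notin> S"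
    using wfE_min[OF wf_mem, of \<kappa> S] by auto
  obtain \<mu>\<^sub>0 where "\<mu>\<^sub>0 \<in> S" "\<mu>\<^sub>0 \<noteq> \<kappa>"
    using False by (auto simp: S_def)
  then have "S - {\<kappa>'} \<noteq> {}"
    using \<open>\<kappa> \<in> S\<close> by blast
  \<comment> \<open>Minimality leaves \<kappa>' as the only possible member of \<open>S\<close>
    below \<theta>. The given \<kappa> may be \<kappa>', \<theta> or something larger.\<close>
  then obtain \<theta> where \<theta>: "\<theta> \<in> S - {\<kappa>'}" "\<And>\<mu>. mem \<mu> \<theta> \<Longrightarrow> \<mu> \<notin> S - {\<kappa>'}"
    using wfE_min[OF wf_mem, of _ "S - {\<kappa>'}"]
    by (metis (mono_tags, lifting) all_not_in_conv case_prodI mem_Collect_eq)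
  \<comment> \<open>\<theta> differs from \<kappa>' and, being in \<open>S\<close>, cannot lie below
    the least element \<kappa>'.\<close>
  have mem: "mem \<kappa>' \<theta>"
    using ordinal_linear[of \<kappa>' \<theta>] ord \<kappa>' \<theta> by blast
  have inacc: "inaccessible \<kappa>'" "inaccessible \<theta>" and model: "models (Vset \<kappa>') mem \<Sigma>"
    using \<kappa>'(1) \<theta>(1) by (auto simp: S_def)
  have unique: "\<mu> = \<kappa>'" if "mem \<mu> \<theta>" "inaccessible \<mu>" "models (Vset \<mu>) mem \<Sigma>" for \<mu>
    using \<theta>(2)[OF that(1)] that by (simp add: S_def)
  have "categorically_characterizes_in (Vset \<theta>) \<Sigma> \<kappa>'"
  proof (rule categorically_characterizesI[OF inacc(1) model])
    obtain v :: 'v where "elts v = Vset \<kappa>'"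
      using Vset_is_set by blast
    moreover from this have "v \<in> Vset \<theta>"
      using Vset_iff mem by blast
    ultimately show "\<exists>v\<in>Vset \<theta>. elts v = Vset \<kappa>'" by blast
  qed (use unique inaccessible_mem_if_eqpoll[OF _ inacc(2)] in blast)
  moreover have "models (Vset \<theta>) mem ZFC2"
    using inaccessible_imp_grothendieck_universe[OF inacc(2)]
    by (rule grothendieck_universe.models_ZFC2)
  ultimately show ?thesis
    using inacc model mem unique by blast
qed

end
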